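(* Let $d\ge 2$ and let $k\ge 1$ be an integer with $k\le d-1$. Then for every $n\ge 2$ and every base-point-free subspace $U\subseteq \mathbb{C}[x_1,\dots,x_n]_d$ of codimension $k$ we have \[ \operatorname{codim} U^2\le k^2+\binom{k+2}{3}=\frac16\,(k^3+9k^2+2k). \]
   Context: $\mathbb{C}[x_1,\dots,x_n]_d$ denotes the vector space of homogeneous polynomials (forms) of degree $d$ in $n$ variables over $\mathbb{C}$. "Subspace" means $\mathbb{C}$-linear subspace. A subspace $U\subseteq\mathbb{C}[x_1,\dots,x_n]_d$ is base-point-free if there is no point $\xi\in\mathbb{P}^{n-1}$ (complex projective space) with $f(\xi)=0$ for all $f\in U$. $U^2$ is the linear span of all products $fg$ with $f,g\in U$. The codimension of $U$ is taken in $\mathbb{C}[x_1,\dots,x_n]_d$, that of $U^2$ in $\mathbb{C}[x_1,\dots,x_n]_{2d}$. *)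

theory Defs
  imports Complex_Main "HOL-Library.Poly_Mapping"
begin

text \<open>
  A monomial is its finitely supported exponent vector, a polynomial a finitely supported
  coefficient function on monomials. The product on polynomials is the convolution product of
  \<^theory>\<open>HOL-Library.Poly_Mapping\<close>. The variables are indexed by all naturals; those of the
  \<open>n\<close>-variable polynomial ring are the ones with index below \<open>n\<close>.
\<close>

type_synonym monomial = "nat \<Rightarrow>\<^sub>0 nat"
type_synonym cpoly = "monomial \<Rightarrow>\<^sub>0 complex"

definition smult :: "complex \<Rightarrow> cpoly \<Rightarrow> cpoly" where
  "smult c p = Poly_Mapping.map ((*) c) p"

lemma lookup_smult [simp]: "Poly_Mapping.lookup (smult c p) m = c * Poly_Mapping.lookup p m"
  by (simp add: smult_def Poly_Mapping.map.rep_eq when_def in_keys_iff)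

global_interpretation cpoly: vector_space smult
  by unfold_locales (auto intro!: poly_mapping_eqI simp: lookup_add algebra_simps)

definition monomials :: "nat \<Rightarrow> nat \<Rightarrow> monomial set" where
  "monomials n d = {m. Poly_Mapping.keys m \<subseteq> {..<n} \<and> (\<Sum>i<n. Poly_Mapping.lookup m i) = d}"

definition forms :: "nat \<Rightarrow> nat \<Rightarrow> cpoly set" where
  "forms n d = {p. Poly_Mapping.keys p \<subseteq> monomials n d}"

definition eval :: "nat \<Rightarrow> (nat \<Rightarrow> complex) \<Rightarrow> cpoly \<Rightarrow> complex" where
  "eval n \<xi> p = (\<Sum>m\<in>Poly_Mapping.keys p. Poly_Mapping.lookup p m * (\<Prod>i<n. \<xi> i ^ Poly_Mapping.lookup m i))"

text \<open>
  A point of projective space is given by homogeneous coordinates \<open>\<xi> 0, \<dots>, \<xi> (n - 1)\<close>, not all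
  zero; by \<open>eval_scale\<close> below, the vanishing of a form does not depend on their choice.
\<close>

definition base_point_free :: "nat \<Rightarrow> cpoly set \<Rightarrow> bool" where
  "base_point_free n U \<longleftrightarrow>
     \<not> (\<exists>\<xi>. (\<exists>i<n. \<xi> i \<noteq> 0) \<and> (\<forall>f\<in>U. eval n \<xi> f = 0))"

definition square_span :: "cpoly set \<Rightarrow> cpoly set" where
  "square_span U = cpoly.span {f * g |f g. f \<in> U \<and> g \<in> U}"

text \<open>
  Used for subspaces \<open>U \<subseteq> V\<close> of a finite-dimensional \<open>V\<close> only, where the subtraction does not
  truncate. The spaces \<open>forms n d\<close> are finite-dimensional by \<open>forms_eq_span\<close> and
  \<open>finite_monomials\<close> below, and \<open>square_span U \<subseteq> forms n (2 * d)\<close> by \<open>square_span_subset_forms\<close>.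
\<close>

definition codim :: "cpoly set \<Rightarrow> cpoly set \<Rightarrow> nat" where
  "codim V U = cpoly.dim V - cpoly.dim U"

lemma eval_scale:
  assumes "p \<in> forms n d"
  shows "eval n (\<lambda>i. c * \<xi> i) p = c ^ d * eval n \<xi> p"
proof -
  have "(\<Prod>i<n. (c * \<xi> i) ^ Poly_Mapping.lookup m i) = c ^ d * (\<Prod>i<n. \<xi> i ^ Poly_Mapping.lookup m i)"
    if "m \<in> Poly_Mapping.keys p" for m
  proof -
    have "(\<Sum>i<n. Poly_Mapping.lookup m i) = d"
      using assms that by (auto simp: forms_def monomials_def)
    then show ?thesis
      by (auto simp: power_mult_distrib prod.distrib power_sum)
  qed
  then show ?thesis
    by (auto simp: eval_def sum_distrib_left intro!: sum.cong)
qed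

lemma finite_monomials: "finite (monomials n d)"
proof -
  have "Poly_Mapping.lookup ` monomials n d \<subseteq> {f. \<forall>i. (i \<in> {..<n} \<longrightarrow> f i \<in> {..d}) \<and> (i \<notin> {..<n} \<longrightarrow> f i = 0)}"
  proof (safe, goal_cases)
    case (1 _ m i)
    then have "Poly_Mapping.lookup m i \<le> (\<Sum>i<n. Poly_Mapping.lookup m i)"
      by (intro member_le_sum) auto
    with 1 show ?case by (simp add: monomials_def)
  next
    case (2 _ m i)
    then show ?case by (auto simp: monomials_def subset_iff in_keys_iff)
  qed
  then have "finite (Poly_Mapping.lookup ` monomials n d)"
    by (rule finite_subset) (intro finite_set_of_finite_funs; simp)
  then show ?thesis
    by (rule finite_imageD) (auto simp: inj_on_def intro: poly_mapping_eqI)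
qed

lemma subspace_forms: "cpoly.subspace (forms n d)"
  unfolding cpoly.subspace_def
proof (intro conjI ballI allI)
  fix p q assume "p \<in> forms n d" "q \<in> forms n d"
  then show "p + q \<in> forms n d"
    using keys_add[of p q] by (auto simp: forms_def)
next
  fix c p assume "p \<in> forms n d"
  then show "smult c p \<in> forms n d"
    by (force simp: forms_def in_keys_iff)
qed (simp add: forms_def)

lemma forms_eq_span:
  "forms n d = cpoly.span ((\<lambda>m. Poly_Mapping.single m 1) ` monomials n d)"
proof
  show "cpoly.span ((\<lambda>m. Poly_Mapping.single m 1) ` monomials n d) \<subseteq> forms n d"
    by (rule cpoly.span_minimal[OF _ subspace_forms]) (auto simp: forms_def)
next
  show "forms n d \<subseteq> cpoly.span ((\<lambda>m. Poly_Mapping.single m 1) ` monomials n d)"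
  proof
    fix p assume p: "p \<in> forms n d"
    have "Poly_Mapping.lookup (\<Sum>m\<in>A. q m) k = (\<Sum>m\<in>A. Poly_Mapping.lookup (q m) k)" for A k and q :: "monomial \<Rightarrow> cpoly"
      by (induction A rule: infinite_finite_induct) (auto simp: lookup_add)
    then have "p = (\<Sum>m\<in>Poly_Mapping.keys p. smult (Poly_Mapping.lookup p m) (Poly_Mapping.single m 1))"
      by (intro poly_mapping_eqI) (simp add: lookup_single when_def in_keys_iff if_distrib cong: if_cong)
    also have "\<dots> \<in> cpoly.span ((\<lambda>m. Poly_Mapping.single m 1) ` monomials n d)"
      using p by (intro cpoly.span_sum cpoly.span_scale cpoly.span_base) (auto simp: forms_def)
    finally show "p \<in> cpoly.span ((\<lambda>m. Poly_Mapping.single m 1) ` monomials n d)" .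
  qed
qed

lemma mult_in_forms:
  assumes "p \<in> forms n a" "q \<in> forms n b"
  shows "p * q \<in> forms n (a + b)"
proof -
  have "l + m \<in> monomials n (a + b)" if "l \<in> monomials n a" "m \<in> monomials n b" for l m
    using that keys_add[of l m] by (auto simp: monomials_def lookup_add sum.distrib)
  then show ?thesis
    using assms keys_mult[of p q] by (force simp: forms_def)
qed

lemma square_span_subset_forms:
  assumes "U \<subseteq> forms n d"
  shows "square_span U \<subseteq> forms n (2 * d)"
  unfolding square_span_def
  using assms by (intro cpoly.span_minimal subspace_forms) (auto simp: mult_2 intro!: mult_in_forms)

end

theory Submission
  imports Defs "HOL-Computational_Algebra.Polynomial" "HOL-Computational_Algebra.Fundamental_Theorem_Algebra"
begin

text \<open>
  Write \<open>A\<^bsub>e\<^esub>\<close> for \<open>forms n e\<close> and \<open>(U : f)\<close> for the forms \<open>p\<close> with \<open>f p \<in> U\<close>. Choose a linear form \<open>l\<close> for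
  which all spaces \<open>U + l\<^sup>e A\<^bsub>d - e\<^esub>\<close> are as large as possible. Differentiating in \<open>l\<close> shows that the
  spaces \<open>J\<^bsub>\<mu>\<^esub> = (U : l\<^bsup>d - \<mu>\<^esup>) + l A\<^bsub>\<mu> - 1\<^esub>\<close> satisfy \<open>A\<^sub>1 J\<^bsub>\<mu>\<^esub> \<subseteq> J\<^bsub>\<mu> + 1\<^esub>\<close>, and their codimensions \<open>\<tau>\<^bsub>\<mu>\<^esub>\<close> add
  up to at most \<open>k\<close>; hence \<open>J\<^bsub>\<mu>\<^esub> = A\<^bsub>\<mu>\<^esub>\<close> for \<open>\<mu> \<ge> k\<close>, in particular for \<open>\<mu> = d\<close> and \<open>\<mu> = d - 1\<close>.

  Put \<open>U\<^sub>0 = U\<close> and \<open>U\<^bsub>i + 1\<^esub> = U + A\<^sub>1 (U\<^bsub>i\<^esub> : l)\<close>. If this chain stopped before \<open>A\<^bsub>d\<^esub>\<close>, the commuting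
  operators \<open>x\<^sub>j / l\<close> on \<open>A\<^bsub>d\<^esub> / U\<^bsub>i\<^esub>\<close> would have a common eigenvector, whose eigenvalues are the
  coordinates of a base point; so it reaches \<open>A\<^bsub>d\<^esub>\<close> after at most \<open>k\<close> strict steps. An element \<open>v\<close> of
  level \<open>i\<close> arises from \<open>U\<close> by \<open>i\<close> multiplications by a variable over \<open>l\<close>; undoing them one by one
  shows that \<open>v l\<^sup>i (U : l\<^sup>i)\<close> has dimension at most \<open>\<Sum>\<^bsub>j \<le> i\<^esub> dim U\<^bsub>j\<^esub> / U\<close> modulo \<open>U\<^sup>2\<close>. Altogether these
  products contribute at most \<open>k + 2\<close> choose \<open>3\<close> dimensions.

  Finally let \<open>V\<close> be a complement of \<open>U\<close> adapted to the filtration by powers of \<open>l\<close>. Then \<open>A\<^bsub>2d\<^esub>\<close> is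
  spanned by \<open>U\<^sup>2\<close>, the products above, \<open>V\<^sup>2\<close> (at most \<open>k + 1\<close> choose \<open>2\<close>) and products
  \<open>l\<^sup>j p v\<close>, where \<open>p\<close> runs over generators of \<open>J\<close> in degree \<open>d - j\<close> and \<open>v\<close> over at most \<open>k - j\<close> elements
  of \<open>V\<close>. Bounding the number of generators by the \<open>\<tau>\<^bsub>\<mu>\<^esub>\<close> yields at most \<open>k\<close> choose \<open>2\<close> of the latter.
\<close>

subsection \<open>Dimensions of subspaces of forms\<close>

context vector_space
begin

text \<open>The polynomial ring has infinite dimension and \<open>dim\<close> is a natural number,
  so all dimensions are compared below a finite spanning set \<open>T\<close>.\<close>

lemma finite_independent_card_le_dim:
  assumes "independent B" "B \<subseteq> span S" "S \<subseteq> span T" "finite T"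
  shows "finite B" "card B \<le> dim S"
proof -
  obtain C where C: "C \<subseteq> S" "independent C" "S \<subseteq> span C" "card C = dim S"
    using basis_exists by blast
  have "finite C"
    using independent_span_bound[OF \<open>finite T\<close> C(2)] C(1) assms(3) by auto
  moreover have "B \<subseteq> span C"
    using assms(2) C(3) by (meson span_minimal subset_trans subspace_span)
  ultimately show "finite B" "card B \<le> dim S"
    using independent_span_bound[of C B] assms(1) C(4) by auto
qed

lemma dim_mono_finite_span:
  assumes "S \<subseteq> span W" "W \<subseteq> span T" "finite T"
  shows "dim S \<le> dim W"
proof -
  obtain B where B: "B \<subseteq> S" "independent B" "S \<subseteq> span B" "card B = dim S"
    using basis_exists by blast
  have "B \<subseteq> span W" using B(1) assms(1) by blast
  from finite_independent_card_le_dim(2)[OF B(2) this assms(2,3)] B(4) show ?thesis by simp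
qed

text \<open>The complement is picked from the prescribed set \<open>C\<close>, so its elements keep
  their shape: later they are multiples of a power of \<open>l\<close>, members of
  \<open>chain\<close>, or elements of a \<open>V\<close> chosen before.\<close>

lemma complement_in_generators:
  assumes "S \<subseteq> span T" "C \<subseteq> span T" "finite T"
  obtains B where "B \<subseteq> C" "finite B" "card B + dim S = dim (S \<union> C)" "C \<subseteq> span (S \<union> B)"
proof -
  obtain S0 where S0: "S0 \<subseteq> S" "independent S0" "S \<subseteq> span S0" "card S0 = dim S"
    using basis_exists by blast
  obtain B where B: "S0 \<subseteq> B" "B \<subseteq> S0 \<union> C" "independent B" "S0 \<union> C \<subseteq> span B"
    using maximal_independent_subset_extend[of S0 "S0 \<union> C"] S0(2) by blast
  have SC: "S \<union> C \<subseteq> span T" using assms by auto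
  have "B \<subseteq> span (S \<union> C)" using B(2) S0(1) span_superset by blast
  then have fin: "finite B"
    using finite_independent_card_le_dim(1)[OF B(3) _ SC assms(3)] by simp
  have "S \<union> C \<subseteq> span B"
    using S0(3) B(1,4) span_mono[OF B(1)] by auto
  moreover have "B \<subseteq> S \<union> C" using B(2) S0(1) by blast
  ultimately have "card B = dim (S \<union> C)"
    using basis_card_eq_dim B(3) by blast
  moreover have "card (B - S0) = card B - card S0" "card S0 \<le> card B"
    using B(1) fin finite_subset card_mono by (auto intro!: card_Diff_subset)
  moreover have "C \<subseteq> span (S \<union> (B - S0))"
  proof -
    have "B \<subseteq> S \<union> (B - S0)" using S0(1) by blast
    from span_mono[OF this] show ?thesis using B(4) by blast
  qed
  ultimately show thesis
    using that[of "B - S0"] B(2) fin S0(4) by auto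
qed

lemma dim_le_dim_plus_card:
  assumes "V \<subseteq> span (S \<union> F)" "S \<subseteq> span T" "finite T" "finite F"
  shows "dim V \<le> dim S + card F"
proof -
  obtain S0 where S0: "S0 \<subseteq> S" "independent S0" "S \<subseteq> span S0" "card S0 = dim S"
    using basis_exists by blast
  have "finite S0"
    using finite_independent_card_le_dim(1)[OF S0(2) _ assms(2,3)] S0(1) span_superset by blast
  moreover have "V \<subseteq> span (S0 \<union> F)"
  proof -
    have "S \<union> F \<subseteq> span (S0 \<union> F)"
      using S0(3) span_mono[of S0 "S0 \<union> F"] span_superset[of "S0 \<union> F"] by blast
    then show ?thesis using assms(1) span_minimal subspace_span by blast
  qed
  ultimately have "dim V \<le> card (S0 \<union> F)"
    using dim_le_card assms(4) by simp
  then show ?thesis using card_Un_le[of S0 F] S0(4) by simp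
qed

lemma subset_if_dim_le:
  assumes "subspace S" "S \<subseteq> V" "V \<subseteq> span T" "finite T" "dim V \<le> dim S"
  shows "V \<subseteq> S"
proof -
  obtain B where B: "B \<subseteq> V" "finite B" "card B + dim S = dim (S \<union> V)" "V \<subseteq> span (S \<union> B)"
    using complement_in_generators[of S T V] assms by blast
  have "S \<union> V = V" using assms(2) by blast
  then have "card B = 0" using B(3) assms(5) by simp
  then have "B = {}" using B(2) by simp
  then show ?thesis using B(4) span_minimal[OF order_refl assms(1)] by auto
qed

end

abbreviation cspan :: "cpoly set \<Rightarrow> cpoly set" where "cspan \<equiv> cpoly.span"

lemma forms_subset_finite_span:
  obtains T where "finite T" "forms n d \<subseteq> cspan T"
  using forms_eq_span[of n d] finite_imageI[OF finite_monomials[of n d]] by (metis order_refl)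

lemma dim_mono_forms:
  assumes "S \<subseteq> cspan W" "W \<subseteq> forms n d"
  shows "cpoly.dim S \<le> cpoly.dim W"
proof -
  obtain T where "finite T" "forms n d \<subseteq> cspan T" by (rule forms_subset_finite_span)
  then show ?thesis using cpoly.dim_mono_finite_span[OF assms(1), of T] assms(2) by auto
qed

lemma complement_in_forms:
  assumes "S \<subseteq> forms n d" "C \<subseteq> forms n d"
  obtains B where "B \<subseteq> C" "finite B" "card B + cpoly.dim S = cpoly.dim (S \<union> C)" "C \<subseteq> cspan (S \<union> B)"
proof -
  obtain T where "finite T" "forms n d \<subseteq> cspan T" by (rule forms_subset_finite_span)
  then show thesis
    using cpoly.complement_in_generators[of S T C thesis] assms that by auto
qed

lemma dim_le_dim_plus_card_forms:
  assumes "V \<subseteq> cspan (S \<union> F)" "S \<subseteq> forms n d" "finite F"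
  shows "cpoly.dim V \<le> cpoly.dim S + card F"
proof -
  obtain T where "finite T" "forms n d \<subseteq> cspan T" by (rule forms_subset_finite_span)
  then show ?thesis using cpoly.dim_le_dim_plus_card[OF assms(1), of T] assms(2,3) by auto
qed

lemma forms_subset_if_dim_le:
  assumes "cpoly.subspace S" "S \<subseteq> V" "V \<subseteq> forms n d" "cpoly.dim V \<le> cpoly.dim S"
  shows "V \<subseteq> S"
proof -
  obtain T where "finite T" "forms n d \<subseteq> cspan T" by (rule forms_subset_finite_span)
  then show ?thesis using cpoly.subset_if_dim_le[OF assms(1,2), of T] assms(3,4) by auto
qed

section \<open>Bilinearity of the product, and the variables as generators\<close>

lemma smult_eq_single_mult: "Defs.smult c p = Poly_Mapping.single 0 c * p"
  by (rule poly_mapping_eqI) (simp add: lookup_mult lookup_single when_mult)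

lemma mult_smult_right [simp]: "p * Defs.smult c q = Defs.smult c (p * q)"
  and mult_smult_left [simp]: "Defs.smult c p * q = Defs.smult c (p * q)"
  by (simp_all add: smult_eq_single_mult algebra_simps)

lemma mult_in_subspace:
  assumes "cpoly.subspace T" "\<And>s. s \<in> S \<Longrightarrow> f * s \<in> T" "g \<in> cspan S"
  shows "f * g \<in> T"
  using assms(3)
proof (induction rule: cpoly.span_induct_alt)
  case base
  then show ?case using assms(1) cpoly.subspace_0 by simp
next
  case (step c x y)
  then show ?case
    using assms(1,2) by (simp add: distrib_left cpoly.subspace_add cpoly.subspace_scale)
qed

lemma mult_in_subspace2:
  assumes "cpoly.subspace T" "\<And>s t. s \<in> S \<Longrightarrow> t \<in> S' \<Longrightarrow> s * t \<in> T" "f \<in> cspan S" "g \<in> cspan S'"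
  shows "f * g \<in> T"
proof (rule mult_in_subspace[OF assms(1) _ assms(4)])
  fix t assume "t \<in> S'"
  then have "t * f \<in> T"
    using mult_in_subspace[OF assms(1) _ assms(3)] assms(2) by (metis mult.commute)
  then show "f * t \<in> T" by (simp add: mult.commute)
qed

definition var :: "nat \<Rightarrow> cpoly" where
  "var i = Poly_Mapping.single (Poly_Mapping.single i 1) 1"

lemma var_in_forms: "i < n \<Longrightarrow> var i \<in> forms n 1"
  by (auto simp: var_def forms_def monomials_def lookup_single when_def)

lemma single_Suc_eq_var_mult:
  assumes "m \<in> monomials n (Suc d)"
  obtains i m' where "i < n" "m' \<in> monomials n d" "m = Poly_Mapping.single i 1 + m'"
proof -
  have "\<exists>i<n. Poly_Mapping.lookup m i \<noteq> 0"
  proof (rule ccontr)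
    assume "\<not> (\<exists>i<n. Poly_Mapping.lookup m i \<noteq> 0)"
    then have "(\<Sum>i<n. Poly_Mapping.lookup m i) = 0" by simp
    then show False using assms by (simp add: monomials_def)
  qed
  then obtain i where i: "i < n" "Poly_Mapping.lookup m i > 0" by auto
  define m' where "m' = m - Poly_Mapping.single i 1"
  have eq: "m = Poly_Mapping.single i 1 + m'"
  proof (rule poly_mapping_eqI)
    fix k show "Poly_Mapping.lookup m k = Poly_Mapping.lookup (Poly_Mapping.single i 1 + m') k"
      using i(2) by (cases "k = i") (simp_all add: m'_def lookup_add lookup_minus lookup_single when_def)
  qed
  have "Poly_Mapping.keys m' \<subseteq> {..<n}"
  proof
    fix j assume "j \<in> Poly_Mapping.keys m'"
    then have "j \<in> Poly_Mapping.keys m"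
      by (auto simp: m'_def in_keys_iff lookup_minus)
    then show "j \<in> {..<n}" using assms by (auto simp: monomials_def)
  qed
  moreover have "(\<Sum>j<n. Poly_Mapping.lookup m j) = 1 + (\<Sum>j<n. Poly_Mapping.lookup m' j)"
  proof -
    have "(\<Sum>j<n. Poly_Mapping.lookup m j)
        = (\<Sum>j<n. Poly_Mapping.lookup (Poly_Mapping.single i 1) j + Poly_Mapping.lookup m' j)"
      by (subst eq) (auto intro!: sum.cong simp: lookup_add)
    also have "\<dots> = 1 + (\<Sum>j<n. Poly_Mapping.lookup m' j)"
      using i(1) by (simp add: sum.distrib lookup_single when_def)
    finally show ?thesis .
  qed
  ultimately have "m' \<in> monomials n d" using assms by (auto simp: monomials_def)
  then show thesis using that i(1) eq by blast
qed

lemma forms_Suc_subset_span: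
  "forms n (Suc d) \<subseteq> cspan {var i * f |i f. i < n \<and> f \<in> forms n d}"
  unfolding forms_eq_span[of n "Suc d"]
proof (rule cpoly.span_mono, safe)
  fix m assume "m \<in> monomials n (Suc d)"
  then obtain i m' where im: "i < n" "m' \<in> monomials n d" "m = Poly_Mapping.single i 1 + m'"
    by (rule single_Suc_eq_var_mult)
  then have "Poly_Mapping.single m (1::complex) = var i * Poly_Mapping.single m' 1"
    by (simp add: var_def mult_single)
  moreover have "Poly_Mapping.single m' 1 \<in> forms n d"
    using im(2) by (auto simp: forms_def)
  ultimately show "\<exists>i f. Poly_Mapping.single m 1 = var i * f \<and> i < n \<and> f \<in> forms n d"
    using im(1) by blast
qed

subsection \<open>Multiplication by all linear forms\<close>

text \<open>The space \<open>A_1 J\<close>; the variables suffice because they span the linear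
  forms.\<close>

definition up :: "nat \<Rightarrow> cpoly set \<Rightarrow> cpoly set" where
  "up n J = cspan {var i * f |i f. i < n \<and> f \<in> J}"

lemma subspace_up [simp]: "cpoly.subspace (up n J)"
  by (simp add: up_def)

lemma var_mult_in_up: "i < n \<Longrightarrow> f \<in> J \<Longrightarrow> var i * f \<in> up n J"
  unfolding up_def by (rule cpoly.span_base) blast

lemma up_subset:
  assumes "cpoly.subspace T" "\<And>i f. i < n \<Longrightarrow> f \<in> J \<Longrightarrow> var i * f \<in> T"
  shows "up n J \<subseteq> T"
  unfolding up_def using assms by (intro cpoly.span_minimal) auto

lemma up_mono: "J \<subseteq> J' \<Longrightarrow> up n J \<subseteq> up n J'"
  unfolding up_def by (rule cpoly.span_mono) blast

lemma var_mult_in_forms: "i < n \<Longrightarrow> f \<in> forms n d \<Longrightarrow> var i * f \<in> forms n (Suc d)"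
  using mult_in_forms[OF var_in_forms, of i n f d] by simp

lemma up_forms: "up n (forms n d) = forms n (Suc d)"
proof
  show "up n (forms n d) \<subseteq> forms n (Suc d)"
    by (rule up_subset[OF subspace_forms var_mult_in_forms])
  show "forms n (Suc d) \<subseteq> up n (forms n d)"
    using forms_Suc_subset_span by (simp add: up_def)
qed

lemma up_in_forms: "J \<subseteq> forms n d \<Longrightarrow> up n J \<subseteq> forms n (Suc d)"
  using up_mono[of J "forms n d" n] by (simp add: up_forms)

section \<open>Bounds for the codimension of \<open>up n J\<close>\<close>

lemma codim_forms_complement:
  assumes "S \<subseteq> forms n d"
  obtains B where "B \<subseteq> forms n d" "finite B" "card B = codim (forms n d) S"
    "forms n d \<subseteq> cspan (S \<union> B)"
proof -
  obtain B where "B \<subseteq> forms n d" "finite B" "card B + cpoly.dim S = cpoly.dim (S \<union> forms n d)"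
    "forms n d \<subseteq> cspan (S \<union> B)"
    by (rule complement_in_forms[OF assms order_refl])
  moreover have "S \<union> forms n d = forms n d" using assms by blast
  ultimately show thesis using that[of B] by (simp add: codim_def)
qed

lemma codim_forms_le_card:
  assumes "forms n d \<subseteq> cspan (S \<union> F)" "S \<subseteq> forms n d" "finite F"
  shows "codim (forms n d) S \<le> card F"
  using dim_le_dim_plus_card_forms[OF assms] by (simp add: codim_def)

lemma dim_le_dim_forms:
  assumes "S \<subseteq> forms n d"
  shows "cpoly.dim S \<le> cpoly.dim (forms n d)"
  by (rule dim_mono_forms[OF subset_trans[OF assms cpoly.span_superset] order_refl])

lemma codim_eq_0_imp_forms_subset:
  assumes "cpoly.subspace S" "S \<subseteq> forms n d" "codim (forms n d) S = 0"
  shows "forms n d \<subseteq> S"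
  using forms_subset_if_dim_le[OF assms(1,2) order_refl] assms(3) by (simp add: codim_def)

lemma codim_less:
  assumes "cpoly.subspace S" "S \<subseteq> S'" "S' \<subseteq> forms n d" "\<not> S' \<subseteq> S"
  shows "codim (forms n d) S' < codim (forms n d) S"
proof -
  have "cpoly.dim S < cpoly.dim S'"
    using forms_subset_if_dim_le[OF assms(1-3)] assms(4) by linarith
  moreover have "cpoly.dim S' \<le> cpoly.dim (forms n d)"
    by (rule dim_le_dim_forms[OF assms(3)])
  ultimately show ?thesis by (simp add: codim_def)
qed

text \<open>With \<open>J' = J + x_i A_e\<close>, the space \<open>up n J'\<close> lies in
  \<open>up n J + x_i A_(e+1)\<close>. Write \<open>A_(e+1)\<close> as \<open>J\<close> plus the
  span of \<open>B\<close>: since \<open>x_i J\<close> is already in \<open>up n J\<close>, only the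
  products \<open>x_i b\<close> with \<open>b\<close> in \<open>B\<close> are new.\<close>

lemma codim_up_step:
  assumes "cpoly.subspace J" "J \<subseteq> forms n (Suc e)" "i < n"
  defines "J' \<equiv> cspan (J \<union> (*) (var i) ` forms n e)"
  shows "codim (forms n (Suc (Suc e))) (up n J)
    \<le> codim (forms n (Suc (Suc e))) (up n J') + codim (forms n (Suc e)) J"
proof -
  obtain B where B: "B \<subseteq> forms n (Suc e)" "finite B" "card B = codim (forms n (Suc e)) J"
    "forms n (Suc e) \<subseteq> cspan (J \<union> B)"
    by (rule codim_forms_complement[OF assms(2)])
  define T where "T = cspan (up n J \<union> (*) (var i) ` B)"
  have T: "cpoly.subspace T" by (simp add: T_def)
  have base: "up n J \<subseteq> T" "(*) (var i) ` B \<subseteq> T"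
    using cpoly.span_superset[of "up n J \<union> (*) (var i) ` B"] unfolding T_def by simp_all
  have gi: "var i * g \<in> T" if "g \<in> forms n (Suc e)" for g
  proof (rule mult_in_subspace[OF T])
    show "g \<in> cspan (J \<union> B)" using that B(4) by blast
    show "var i * s \<in> T" if "s \<in> J \<union> B" for s
      using that base var_mult_in_up[OF \<open>i < n\<close>] by blast
  qed
  have "up n J' \<subseteq> T"
  proof (rule up_subset[OF T])
    fix j f assume "j < n" "f \<in> J'"
    show "var j * f \<in> T"
    proof (rule mult_in_subspace[OF T _ \<open>f \<in> J'\<close>[unfolded J'_def]])
      fix s assume "s \<in> J \<union> (*) (var i) ` forms n e"
      then show "var j * s \<in> T"
      proof
        assume "s \<in> J" then show ?thesis using base var_mult_in_up[OF \<open>j < n\<close>] by blast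
      next
        assume "s \<in> (*) (var i) ` forms n e"
        then obtain g where g: "g \<in> forms n e" "s = var i * g" by blast
        then show ?thesis
          using gi[OF var_mult_in_forms[OF \<open>j < n\<close> g(1)]] by (simp add: mult.left_commute)
      qed
    qed
  qed
  then have "cpoly.dim (up n J') \<le> cpoly.dim (up n J) + card ((*) (var i) ` B)"
    unfolding T_def by (rule dim_le_dim_plus_card_forms) (use B(2) up_in_forms[OF assms(2)] in auto)
  moreover have "card ((*) (var i) ` B) \<le> card B" by (rule card_image_le[OF B(2)])
  ultimately show ?thesis using B(3) by (simp add: codim_def)
qed

lemma exists_var_not_absorbed:
  assumes "cpoly.subspace J" "\<not> forms n (Suc e) \<subseteq> J"
  obtains i where "i < n" "\<not> (*) (var i) ` forms n e \<subseteq> J"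
proof -
  have "\<exists>i<n. \<not> (*) (var i) ` forms n e \<subseteq> J"
  proof (rule ccontr)
    assume "\<not> (\<exists>i<n. \<not> (*) (var i) ` forms n e \<subseteq> J)"
    then have "up n (forms n e) \<subseteq> J" by (intro up_subset[OF assms(1)]) blast
    then show False using assms(2) by (simp add: up_forms)
  qed
  then show thesis using that by blast
qed

lemma extend_by_var:
  assumes "cpoly.subspace J" "J \<subseteq> forms n (Suc e)" "i < n" "\<not> (*) (var i) ` forms n e \<subseteq> J"
  defines "J' \<equiv> cspan (J \<union> (*) (var i) ` forms n e)"
  shows "J' \<subseteq> forms n (Suc e)" "codim (forms n (Suc e)) J' < codim (forms n (Suc e)) J"
proof -
  show sub: "J' \<subseteq> forms n (Suc e)"
    unfolding J'_def using assms(2) var_mult_in_forms[OF \<open>i < n\<close>]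
    by (intro cpoly.span_minimal[OF _ subspace_forms]) blast
  have "J \<subseteq> J'" "(*) (var i) ` forms n e \<subseteq> J'"
    using cpoly.span_superset[of "J \<union> (*) (var i) ` forms n e"] unfolding J'_def by simp_all
  then show "codim (forms n (Suc e)) J' < codim (forms n (Suc e)) J"
    using codim_less[OF assms(1) _ sub] assms(4) by blast
qed

lemma codim_up_full:
  assumes "J \<subseteq> forms n (Suc e)" "forms n (Suc e) \<subseteq> J"
  shows "codim (forms n (Suc (Suc e))) (up n J) = 0"
proof -
  have "J = forms n (Suc e)" using assms by blast
  then show ?thesis by (simp add: up_forms codim_def)
qed

lemma forms_add_subset_span:
  "forms n (a + b) \<subseteq> cspan {f * g |f g. f \<in> forms n a \<and> g \<in> forms n b}"
proof (induction a)
  case 0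
  have "1 \<in> forms n 0" by (auto simp: forms_def monomials_def simp flip: single_one)
  then have "f \<in> {f * g |f g. f \<in> forms n 0 \<and> g \<in> forms n b}" if "f \<in> forms n b" for f
    using that by (intro CollectI exI[of _ 1] exI[of _ f]) simp
  then show ?case using cpoly.span_superset by fastforce
next
  case (Suc a)
  let ?T = "cspan {f * g |f g. f \<in> forms n (Suc a) \<and> g \<in> forms n b}"
  have "up n (forms n (a + b)) \<subseteq> ?T"
  proof (rule up_subset)
    fix i f assume "i < n" "f \<in> forms n (a + b)"
    show "var i * f \<in> ?T"
    proof (rule mult_in_subspace[OF _ _ subsetD[OF Suc \<open>f \<in> forms n (a + b)\<close>]])
      fix s assume "s \<in> {f * g |f g. f \<in> forms n a \<and> g \<in> forms n b}"
      then obtain f g where "s = f * g" "f \<in> forms n a" "g \<in> forms n b" by blast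
      then have "var i * s = (var i * f) * g" "var i * f \<in> forms n (Suc a)"
        using var_mult_in_forms[OF \<open>i < n\<close>] by (simp_all add: mult.assoc)
      then show "var i * s \<in> ?T" using \<open>g \<in> forms n b\<close> by (intro cpoly.span_base) blast
    qed simp
  qed simp
  then show ?case by (simp add: up_forms)
qed

text \<open>Enlarge \<open>J\<close> by spaces \<open>x_i A_e\<close> until it is everything. The
  codimension drops at every step, so by \<open>codim_up_step\<close> the costs are at most
  \<open>c\<close>, \<open>c - 1\<close>, ..., \<open>1\<close>, where \<open>c\<close> is the
  initial codimension.\<close>

lemma codim_up_le_choose:
  assumes "cpoly.subspace J" "J \<subseteq> forms n (Suc e)"
  shows "codim (forms n (Suc (Suc e))) (up n J) \<le> Suc (codim (forms n (Suc e)) J) choose 2"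
  using assms
proof (induction "codim (forms n (Suc e)) J" arbitrary: J rule: less_induct)
  case less
  let ?c = "codim (forms n (Suc e))"
  show ?case
  proof (cases "forms n (Suc e) \<subseteq> J")
    case True
    then show ?thesis using codim_up_full[OF less.prems(2)] by simp
  next
    case False
    then obtain i where i: "i < n" "\<not> (*) (var i) ` forms n e \<subseteq> J"
      using exists_var_not_absorbed less.prems(1) by blast
    define J' where "J' = cspan (J \<union> (*) (var i) ` forms n e)"
    have J': "J' \<subseteq> forms n (Suc e)" "?c J' < ?c J"
      unfolding J'_def using extend_by_var[OF less.prems i] by auto
    have "codim (forms n (Suc (Suc e))) (up n J) \<le> (Suc (?c J') choose 2) + ?c J"
      using codim_up_step[OF less.prems i(1)] less.hyps[OF J'(2) _ J'(1)]
      by (simp add: J'_def)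
    also have "Suc (?c J') choose 2 \<le> ?c J choose 2"
      using J'(2) by (intro binomial_right_mono) simp
    also have "(?c J choose 2) + ?c J = Suc (?c J) choose 2"
      by (simp add: numeral_2_eq_2)
    finally show ?thesis by simp
  qed
qed

text \<open>The same enlargement is run on \<open>K\<close> in parallel. Every step costs at most
  the initial codimension of \<open>J\<close>, and \<open>K\<close> grows strictly too, so its
  codimension bounds the number of steps.\<close>

lemma codim_up_le_mult:
  assumes "cpoly.subspace J" "J \<subseteq> forms n (Suc e)"
    and "cpoly.subspace K" "K \<subseteq> forms n (Suc a)" "a \<le> e"
    and "\<And>g h. g \<in> forms n (e - a) \<Longrightarrow> h \<in> K \<Longrightarrow> g * h \<in> J"
  shows "codim (forms n (Suc (Suc e))) (up n J) \<le> codim (forms n (Suc e)) J * codim (forms n (Suc a)) K"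
  using assms
proof (induction "codim (forms n (Suc e)) J" arbitrary: J K rule: less_induct)
  case less
  let ?c = "codim (forms n (Suc e))" and ?b = "codim (forms n (Suc a))"
  show ?case
  proof (cases "forms n (Suc e) \<subseteq> J")
    case True
    then show ?thesis using codim_up_full[OF less.prems(2)] by simp
  next
    case False
    then obtain i where i: "i < n" "\<not> (*) (var i) ` forms n e \<subseteq> J"
      using exists_var_not_absorbed less.prems(1) by blast
    define J' where "J' = cspan (J \<union> (*) (var i) ` forms n e)"
    define K' where "K' = cspan (K \<union> (*) (var i) ` forms n a)"
    have J': "J' \<subseteq> forms n (Suc e)" "?c J' < ?c J" "cpoly.subspace J'" "J \<subseteq> J'"
      "(*) (var i) ` forms n e \<subseteq> J'"
      using extend_by_var[OF less.prems(1,2) i] cpoly.span_superset[of "J \<union> (*) (var i) ` forms n e"]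
      unfolding J'_def by simp_all
    \<comment> \<open>Otherwise \<open>x_i A_e\<close>, which is spanned by the products in
      \<open>A_(e-a) (x_i A_a)\<close>, would lie in \<open>J\<close>, against the choice of
      \<open>i\<close>.\<close>
    have "\<not> (*) (var i) ` forms n a \<subseteq> K"
    proof
      assume sub: "(*) (var i) ` forms n a \<subseteq> K"
      have "var i * f \<in> J" if "f \<in> forms n e" for f
      proof -
        have "f \<in> cspan {g * t |g t. g \<in> forms n (e - a) \<and> t \<in> forms n a}"
          using that forms_add_subset_span[of n "e - a" a] \<open>a \<le> e\<close> by auto
        then show ?thesis
        proof (rule mult_in_subspace[OF less.prems(1), rotated])
          fix s assume "s \<in> {g * t |g t. g \<in> forms n (e - a) \<and> t \<in> forms n a}"
          then obtain g t where "s = g * t" "g \<in> forms n (e - a)" "var i * t \<in> K"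
            using sub by blast
          then show "var i * s \<in> J"
            using less.prems(6)[of g "var i * t"] by (simp add: mult.left_commute)
        qed
      qed
      then show False using i(2) by blast
    qed
    then have K': "K' \<subseteq> forms n (Suc a)" "?b K' < ?b K"
      unfolding K'_def using extend_by_var[OF less.prems(3,4) i(1)] by auto
    have "g * h \<in> J'" if g: "g \<in> forms n (e - a)" and h: "h \<in> K'" for g h
    proof (rule mult_in_subspace[OF J'(3) _ h[unfolded K'_def]])
      fix s assume "s \<in> K \<union> (*) (var i) ` forms n a"
      then show "g * s \<in> J'"
      proof
        assume "s \<in> K" then show ?thesis using less.prems(6)[OF g] J'(4) by blast
      next
        assume "s \<in> (*) (var i) ` forms n a"
        then obtain t where t: "t \<in> forms n a" "s = var i * t" by blast
        have "g * t \<in> forms n e" using mult_in_forms[OF g t(1)] less.prems(5) by simp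
        then show ?thesis using J'(5) t(2) by (auto simp: mult.left_commute)
      qed
    qed
    then have "codim (forms n (Suc (Suc e))) (up n J') \<le> ?c J' * ?b K'"
      using less.hyps[OF J'(2,3,1) _ K'(1) less.prems(5)] by (simp add: K'_def)
    also have "\<dots> \<le> ?c J * (?b K - 1)"
      using J'(2) K'(2) by (intro mult_le_mono) auto
    finally have "codim (forms n (Suc (Suc e))) (up n J) \<le> ?c J * (?b K - 1) + ?c J"
      using codim_up_step[OF less.prems(1,2) i(1), folded J'_def] by linarith
    also have "\<dots> = ?c J * ?b K"
      using K'(2) by (cases "?b K") auto
    finally show ?thesis .
  qed
qed

subsection \<open>Perturbing a linear form\<close>

abbreviation const :: "complex \<Rightarrow> cpoly" where "const c \<equiv> Poly_Mapping.single 0 c"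

lemma const_power: "const c ^ s = const (c ^ s)"
  by (induction s) (simp_all add: mult_single)

text \<open>Independence for an indexed family: the condition on the coefficients also forces
  \<open>g\<close> to be injective, by testing \<open>1\<close> and \<open>- 1\<close> at a
  collision.\<close>

lemma card_le_dim_if_combinations_trivial:
  assumes "finite I" "\<And>i. i \<in> I \<Longrightarrow> g i \<in> S" "S \<subseteq> forms n d"
    and "\<And>c. (\<Sum>i\<in>I. const (c i) * g i) = 0 \<Longrightarrow> \<forall>i\<in>I. c i = 0"
  shows "card I \<le> cpoly.dim S"
proof -
  have inj: "inj_on g I"
  proof (rule inj_onI, rule ccontr)
    fix i j assume ij: "i \<in> I" "j \<in> I" "g i = g j" "i \<noteq> j"
    define c :: "_ \<Rightarrow> complex" where "c = (\<lambda>x. if x = i then 1 else if x = j then - 1 else 0)"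
    have "(\<Sum>x\<in>I. const (c x) * g x) = (\<Sum>x\<in>{i, j}. const (c x) * g x)"
      using ij assms(1) by (intro sum.mono_neutral_right) (auto simp: c_def)
    also have "\<dots> = 0" using ij(3,4) by (simp add: c_def single_uminus)
    finally show False using assms(4)[of c] ij(1) by (auto simp: c_def)
  qed
  have "cpoly.independent (g ` I)"
  proof (rule cpoly.independent_if_scalars_zero)
    fix f x assume "(\<Sum>x\<in>g ` I. Defs.smult (f x) x) = 0" "x \<in> g ` I"
    then show "f x = 0"
      using assms(4)[of "f \<circ> g"] by (auto simp: sum.reindex[OF inj] smult_eq_single_mult)
  qed (use assms(1) in simp)
  moreover obtain T where "finite T" "forms n d \<subseteq> cspan T" by (rule forms_subset_finite_span)
  moreover have "g ` I \<subseteq> cspan S" using assms(2) cpoly.span_superset[of S] by auto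
  ultimately have "card (g ` I) \<le> cpoly.dim S"
    using cpoly.finite_independent_card_le_dim(2)[of "g ` I" S T] assms(3) by auto
  then show ?thesis using card_image[OF inj] by simp
qed

text \<open>Diagonal dominance: in the row of an entry \<open>c i\<close> of largest norm, the
  deviations from the identity sum to less than \<open>1\<close>.\<close>

lemma trivial_kernel_near_identity:
  fixes a :: "'i \<Rightarrow> 'i \<Rightarrow> complex"
  assumes "finite I"
    and near: "\<And>i j. i \<in> I \<Longrightarrow> j \<in> I \<Longrightarrow> norm (a i j - (if i = j then 1 else 0)) < 1 / (card I + 1)"
    and zero: "\<And>i. i \<in> I \<Longrightarrow> (\<Sum>j\<in>I. c j * a i j) = 0"
  shows "\<forall>i\<in>I. c i = 0"
proof (rule ccontr)
  assume "\<not> (\<forall>i\<in>I. c i = 0)"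
  then have "I \<noteq> {}" by auto
  obtain i where i: "i \<in> I" "\<And>j. j \<in> I \<Longrightarrow> norm (c j) \<le> norm (c i)"
    using finite_has_maximal[of "(\<lambda>j. norm (c j)) ` I"] \<open>I \<noteq> {}\<close> assms(1)
    by (smt (verit, del_insts) finite_imageI image_iff image_is_empty)
  obtain j where "j \<in> I" "c j \<noteq> 0" using \<open>\<not> (\<forall>i\<in>I. c i = 0)\<close> by blast
  then have pos: "norm (c i) > 0" using i(2)[of j] by (metis less_le_trans zero_less_norm_iff)
  have "c i = (\<Sum>j\<in>I. c j * (if i = j then 1 else 0))"
    using i(1) assms(1) by (simp add: if_distrib cong: if_cong)
  also have "\<dots> = - (\<Sum>j\<in>I. c j * (a i j - (if i = j then 1 else 0)))"
    using zero[OF i(1)] by (simp add: right_diff_distrib sum_subtractf)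
  finally have "norm (c i) = norm (\<Sum>j\<in>I. c j * (a i j - (if i = j then 1 else 0)))"
    by (simp only: norm_minus_cancel)
  also have "\<dots> \<le> (\<Sum>j\<in>I. norm (c j * (a i j - (if i = j then 1 else 0))))"
    by (rule norm_sum)
  also have "\<dots> \<le> (\<Sum>j\<in>I. norm (c i) * (1 / (card I + 1)))"
    unfolding norm_mult using near[OF i(1)] i(2)
    by (intro sum_mono mult_mono) (auto simp: less_imp_le)
  also have "\<dots> = norm (c i) * (card I / (card I + 1))" by simp
  also have "\<dots> < norm (c i)" using pos by (simp add: field_simps)
  finally show False by simp
qed

text \<open>Coordinates of \<open>poly G (const t)\<close> are polynomial functions of
  \<open>t\<close>, so limits can be taken coordinatewise, without a topology on
  polynomials.\<close>

lemma representation_poly_const: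
  assumes "cpoly.independent E" "cpoly.span E = UNIV"
  shows "cpoly.representation E (poly G (const t)) b
    = (\<Sum>s\<le>degree G. t ^ s * cpoly.representation E (coeff G s) b)"
proof -
  have "poly G (const t) = (\<Sum>s\<le>degree G. Defs.smult (t ^ s) (coeff G s))"
    by (simp add: poly_altdef const_power smult_eq_single_mult mult.commute)
  then show ?thesis
    using assms by (simp add: cpoly.representation_sum cpoly.representation_scale)
qed

text \<open>Lower semicontinuity of dimension. Near \<open>0\<close> the
  \<open>W\<close>-coordinates of the curves form a matrix close to the identity, so the curves stay
  independent. They have to lie in \<open>S t\<close> only for \<open>t \<noteq> 0\<close>, which
  admits limits of difference quotients.\<close>

lemma eventually_card_le_dim:
  assumes "finite W" "cpoly.independent W" "\<And>t. S t \<subseteq> forms n d"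
    and "\<And>w. w \<in> W \<Longrightarrow> \<exists>G. poly G 0 = w \<and> (\<forall>t. t \<noteq> 0 \<longrightarrow> poly G (const t) \<in> S t)"
  shows "\<forall>\<^sub>F t in at 0. card W \<le> cpoly.dim (S t)"
proof -
  obtain G where G: "\<And>w. w \<in> W \<Longrightarrow> poly (G w) 0 = w"
    "\<And>w t. w \<in> W \<Longrightarrow> t \<noteq> 0 \<Longrightarrow> poly (G w) (const t) \<in> S t"
    using assms(4) by metis
  define E where "E = cpoly.extend_basis W"
  have E: "W \<subseteq> E" "cpoly.independent E" "cpoly.span E = UNIV"
    unfolding E_def using assms(2)
    by (simp_all add: cpoly.extend_basis_superset cpoly.independent_extend_basis)
  define a where "a t v w = cpoly.representation E (poly (G w) (const t)) v" for t v w
  have "\<forall>\<^sub>F t in at 0. norm (a t v w - (if v = w then 1 else 0)) < 1 / (card W + 1)"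
    if "v \<in> W" "w \<in> W" for v w
  proof -
    have "((\<lambda>t. \<Sum>s\<le>degree (G w). t ^ s * cpoly.representation E (coeff (G w) s) v)
        \<longlongrightarrow> (\<Sum>s\<le>degree (G w). 0 ^ s * cpoly.representation E (coeff (G w) s) v)) (at 0)"
      by (intro tendsto_intros)
    then have "((\<lambda>t. a t v w) \<longlongrightarrow> a 0 v w) (at 0)"
      unfolding a_def representation_poly_const[OF E(2,3)] .
    moreover have "a 0 v w = (if v = w then 1 else 0)"
      unfolding a_def using G(1) that E cpoly.representation_basis[OF E(2), of w] by auto
    ultimately show ?thesis by (auto dest!: tendstoD[of _ _ _ "1 / (card W + 1)"] simp: dist_norm)
  qed
  then have "\<forall>\<^sub>F t in at 0. \<forall>v\<in>W. \<forall>w\<in>W. norm (a t v w - (if v = w then 1 else 0)) < 1 / (card W + 1)"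
    by (intro eventually_ball_finite ballI assms(1))
  moreover have "\<forall>\<^sub>F t in at (0::complex). t \<noteq> 0" by (simp add: eventually_at_filter)
  ultimately show ?thesis
  proof eventually_elim
    case (elim t)
    show ?case
    proof (rule card_le_dim_if_combinations_trivial[where g = "\<lambda>w. poly (G w) (const t)"])
      fix c assume "(\<Sum>w\<in>W. const (c w) * poly (G w) (const t)) = 0"
      then have eq: "(\<Sum>w\<in>W. Defs.smult (c w) (poly (G w) (const t))) = 0"
        by (simp add: smult_eq_single_mult)
      have "(\<Sum>w\<in>W. c w * a t v w) = 0" for v
      proof -
        have "(\<Sum>w\<in>W. c w * a t v w)
            = cpoly.representation E (\<Sum>w\<in>W. Defs.smult (c w) (poly (G w) (const t))) v"
          using E by (simp add: a_def cpoly.representation_sum cpoly.representation_scale)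
        then show ?thesis by (simp add: eq cpoly.representation_zero)
      qed
      then show "\<forall>w\<in>W. c w = 0"
        using trivial_kernel_near_identity[OF assms(1), of "a t" c] elim(1) by blast
    qed (use assms(1,3) G(2) elim(2) in auto)
  qed
qed

definition lspan :: "nat \<Rightarrow> nat \<Rightarrow> cpoly set \<Rightarrow> cpoly \<Rightarrow> nat \<Rightarrow> cpoly set" where
  "lspan n d U l e = cspan (U \<union> (*) (l ^ e) ` forms n (d - e))"

text \<open>Each summand is lower semicontinuous in \<open>l\<close>, so maximality of the sum
  forbids the growth of any single summand nearby.\<close>

definition total_rank :: "nat \<Rightarrow> nat \<Rightarrow> cpoly set \<Rightarrow> cpoly \<Rightarrow> nat" where
  "total_rank n d U l = (\<Sum>e\<le>d. cpoly.dim (lspan n d U l e))"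

lemma power_in_forms:
  assumes "l \<in> forms n 1"
  shows "l ^ e \<in> forms n e"
proof (induction e)
  case 0
  show ?case by (auto simp: forms_def monomials_def simp flip: single_one)
next
  case (Suc e)
  then show ?case using mult_in_forms[OF assms, of "l ^ e" e] by simp
qed

lemma power_mult_in_forms:
  assumes "l \<in> forms n 1" "e \<le> d" "f \<in> forms n (d - e)"
  shows "l ^ e * f \<in> forms n d"
  using mult_in_forms[OF power_in_forms[OF assms(1), of e] assms(3)] assms(2) by simp

lemma subspace_lspan [simp]: "cpoly.subspace (lspan n d U l e)"
  by (simp add: lspan_def)

lemma lspan_in_forms:
  assumes "l \<in> forms n 1" "e \<le> d" "U \<subseteq> forms n d"
  shows "lspan n d U l e \<subseteq> forms n d"
  unfolding lspan_def
  using assms power_mult_in_forms by (intro cpoly.span_minimal subspace_forms) auto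

lemma in_lspan: "f \<in> U \<Longrightarrow> f \<in> lspan n d U l e"
  and power_mult_in_lspan: "g \<in> forms n (d - e) \<Longrightarrow> l ^ e * g \<in> lspan n d U l e"
  unfolding lspan_def by (auto intro: cpoly.span_base)

lemma linear_pencil_in_forms:
  assumes "l \<in> forms n 1" "m \<in> forms n 1"
  shows "l + const t * m \<in> forms n 1"
  using assms subspace_forms[of n 1]
  by (auto simp flip: smult_eq_single_mult intro: cpoly.subspace_add cpoly.subspace_scale)

text \<open>The second coefficient of \<open>(l + t m) ^ (e + 1) p\<close>, a limit of elements of
  \<open>lspan n d U (l + t m) (e + 1)\<close> when \<open>l ^ (e + 1) p \<in> U\<close>.\<close>

lemma pencil_difference_quotient:
  fixes l m p :: cpoly
  obtains G where "poly G 0 = of_nat (Suc e) * (l ^ e * m * p)"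
    "\<And>x. (l + x * m) ^ Suc e * p = l ^ Suc e * p + x * poly G x"
proof -
  define F where "F = [:l, m:] ^ Suc e * [:p:]"
  obtain a G where FG: "F = pCons a G" by (cases F)
  have F: "poly F x = (l + x * m) ^ Suc e * p" for x
    by (simp add: F_def algebra_simps)
  have a: "a = l ^ Suc e * p" using F[of 0] by (simp add: FG)
  have "poly G 0 = coeff F 1" by (simp add: FG poly_0_coeff_0)
  also have "\<dots> = coeff (pderiv F) 0" by (simp add: coeff_pderiv)
  also have "pderiv F = Polynomial.smult (of_nat (Suc e)) ([:l, m:] ^ e) * [:m:] * [:p:]"
    unfolding F_def pderiv_mult pderiv_power_Suc by (simp add: pderiv_pCons algebra_simps)
  also have "coeff \<dots> 0 = of_nat (Suc e) * (l ^ e * m * p)"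
    by (simp add: coeff_0_power coeff_mult_0 algebra_simps)
  finally show thesis
    using that[of G] F by (simp add: FG a)
qed

text \<open>If the element were missing, replace \<open>l\<close> by \<open>l + t m\<close> for
  small \<open>t\<close>. No summand of \<open>total_rank\<close> drops, while the one for
  \<open>Suc e\<close> gains the limit \<open>(e+1) l^e m p\<close> of
  \<open>((l + t m)^(e+1) p - l^(e+1) p) / t\<close>. The quotient lies in the perturbed space
  because \<open>l^(e+1) p\<close> is in \<open>U\<close>.\<close>

lemma maximal_total_rank_absorbs:
  assumes U: "cpoly.subspace U" "U \<subseteq> forms n d" and l: "l \<in> forms n 1"
    and max: "\<And>l'. l' \<in> forms n 1 \<Longrightarrow> total_rank n d U l' \<le> total_rank n d U l"
    and e: "e < d" and p: "p \<in> forms n (d - Suc e)" "l ^ Suc e * p \<in> U" and m: "m \<in> forms n 1"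
  shows "l ^ e * m * p \<in> lspan n d U l (Suc e)"
proof (rule ccontr)
  assume notin: "l ^ e * m * p \<notin> lspan n d U l (Suc e)"
  define S where "S e' t = lspan n d U (l + const t * m) e'" for e' t
  define Y where "Y e' = U \<union> (*) (l ^ e') ` forms n (d - e')" for e'
  have S_forms: "S e' t \<subseteq> forms n d" if "e' \<le> d" for e' t
    unfolding S_def by (rule lspan_in_forms[OF linear_pencil_in_forms[OF l m] that U(2)])
  \<comment> \<open>Elements of \<open>U\<close> are constant curves; \<open>l^e' q\<close> moves
    along \<open>(l + t m)^e' q\<close>.\<close>
  have lift: "\<exists>G. poly G 0 = w \<and> (\<forall>t. t \<noteq> 0 \<longrightarrow> poly G (const t) \<in> S e' t)" if w: "w \<in> Y e'" for w e'
  proof (cases "w \<in> U")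
    case True
    then show ?thesis by (intro exI[of _ "[:w:]"]) (simp add: S_def in_lspan)
  next
    case False
    then obtain q where q: "q \<in> forms n (d - e')" "w = l ^ e' * q" using w by (auto simp: Y_def)
    define G where "G = [:l, m:] ^ e' * [:q:]"
    have "poly G x = (l + x * m) ^ e' * q" for x by (simp add: G_def)
    with q show ?thesis
      unfolding S_def by (intro exI[of _ G]) (simp add: power_mult_in_lspan)
  qed
  have basis: "\<exists>B. B \<subseteq> Y e' \<and> finite B \<and> cpoly.independent B \<and> card B = cpoly.dim (lspan n d U l e')
      \<and> cspan B = lspan n d U l e'" if "e' \<le> d" for e'
  proof -
    obtain B where B: "B \<subseteq> Y e'" "cpoly.independent B" "Y e' \<subseteq> cspan B" "card B = cpoly.dim (Y e')"
      using cpoly.basis_exists by blast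
    have Yf: "Y e' \<subseteq> forms n d" unfolding Y_def using U(2) power_mult_in_forms[OF l that] by auto
    obtain T where "finite T" "forms n d \<subseteq> cspan T" by (rule forms_subset_finite_span)
    then have "finite B"
      using cpoly.finite_independent_card_le_dim(1)[OF B(2), of "Y e'" T] B(1) Yf cpoly.span_superset[of "Y e'"]
      by auto
    moreover have "cspan B = cspan (Y e')"
      using B(1,3) cpoly.span_mono[OF B(1)] cpoly.span_minimal[OF B(3)] by auto
    moreover have "cpoly.dim (cspan (Y e')) = cpoly.dim (Y e')" by simp
    ultimately show ?thesis using B by (auto simp: lspan_def Y_def)
  qed
  have ge: "\<forall>\<^sub>F t in at 0. cpoly.dim (lspan n d U l e') \<le> cpoly.dim (S e' t)" if "e' \<le> d" for e'
  proof -
    obtain B where B: "B \<subseteq> Y e'" "finite B" "cpoly.independent B" "card B = cpoly.dim (lspan n d U l e')"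
      using basis[OF \<open>e' \<le> d\<close>] by blast
    have "\<forall>\<^sub>F t in at 0. card B \<le> cpoly.dim (S e' t)"
      using lift B(1) S_forms[OF \<open>e' \<le> d\<close>] by (intro eventually_card_le_dim[OF B(2,3), of "S e'" n d]) auto
    then show ?thesis by (simp add: B(4))
  qed
  have "\<forall>\<^sub>F t in at 0. Suc (cpoly.dim (lspan n d U l (Suc e))) \<le> cpoly.dim (S (Suc e) t)"
  proof -
    have "Suc e \<le> d" using e by simp
    then obtain B where B: "B \<subseteq> Y (Suc e)" "finite B" "cpoly.independent B"
      "card B = cpoly.dim (lspan n d U l (Suc e))" "cspan B = lspan n d U l (Suc e)"
      using basis by meson
    define x where "x = of_nat (Suc e) * (l ^ e * m * p)"
    have x: "x = Defs.smult (of_nat (Suc e)) (l ^ e * m * p)"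
      by (simp add: x_def smult_eq_single_mult del: of_nat_Suc)
    \<comment> \<open>Characteristic zero enters here: the factor \<open>Suc e\<close> can be
      divided out.\<close>
    have x_notin: "x \<notin> cspan B"
    proof
      assume "x \<in> cspan B"
      from cpoly.span_scale[OF this, of "1 / of_nat (Suc e)"]
      have "l ^ e * m * p \<in> cspan B" by (simp add: x del: of_nat_Suc)
      then show False using notin B(5) by simp
    qed
    then have "x \<notin> B" using cpoly.span_base by blast
    obtain G where G: "poly G 0 = x" "\<And>y. (l + y * m) ^ Suc e * p = l ^ Suc e * p + y * poly G y"
      unfolding x_def using pencil_difference_quotient by metis
    have "poly G (const t) \<in> S (Suc e) t" if "t \<noteq> 0" for t
    proof -
      have "(l + const t * m) ^ Suc e * p - l ^ Suc e * p \<in> S (Suc e) t"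
        unfolding S_def
        by (rule cpoly.subspace_diff[OF subspace_lspan power_mult_in_lspan[OF p(1)] in_lspan[OF p(2)]])
      then have "Defs.smult t (poly G (const t)) \<in> S (Suc e) t"
        unfolding G(2) by (simp add: smult_eq_single_mult)
      then have "Defs.smult (1 / t) (Defs.smult t (poly G (const t))) \<in> S (Suc e) t"
        unfolding S_def by (rule cpoly.subspace_scale[OF subspace_lspan])
      then show ?thesis using that by simp
    qed
    then have "\<forall>\<^sub>F t in at 0. card (insert x B) \<le> cpoly.dim (S (Suc e) t)"
      using lift B(1) G(1) S_forms[OF \<open>Suc e \<le> d\<close>] B(2) cpoly.independent_insertI[OF x_notin B(3)]
      by (intro eventually_card_le_dim[of _ "S (Suc e)" n d]) auto
    then show ?thesis using \<open>x \<notin> B\<close> B(2,4) by simp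
  qed
  moreover have "\<forall>\<^sub>F t in at 0. \<forall>e'\<in>{..d}. cpoly.dim (lspan n d U l e') \<le> cpoly.dim (S e' t)"
    using ge by (intro eventually_ball_finite) auto
  ultimately have "\<forall>\<^sub>F t in at 0. total_rank n d U l < total_rank n d U (l + const t * m)"
  proof eventually_elim
    case (elim t)
    then show ?case
      unfolding total_rank_def S_def using e by (intro sum_strict_mono_ex1) (auto intro!: bexI[of _ "Suc e"])
  qed
  then obtain t where "total_rank n d U l < total_rank n d U (l + const t * m)"
    using eventually_happens[of _ "at (0::complex)"] by auto
  then show False using max[OF linear_pencil_in_forms[OF l m, of t]] by simp
qed

lemma exists_maximal_total_rank:
  assumes "U \<subseteq> forms n d"
  shows "\<exists>l\<in>forms n 1. \<forall>l'\<in>forms n 1. total_rank n d U l' \<le> total_rank n d U l"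
proof -
  have "total_rank n d U l \<le> Suc d * cpoly.dim (forms n d)" if "l \<in> forms n 1" for l
  proof -
    have "total_rank n d U l \<le> (\<Sum>e\<le>d. cpoly.dim (forms n d))"
      unfolding total_rank_def
      using that assms by (intro sum_mono dim_le_dim_forms lspan_in_forms) auto
    then show ?thesis by simp
  qed
  moreover have "0 \<in> forms n 1" by (simp add: forms_def)
  ultimately obtain l where "l \<in> forms n 1"
    "\<forall>l'. l' \<in> forms n 1 \<longrightarrow> total_rank n d U l' \<le> total_rank n d U l"
    using ex_has_greatest_nat[of "\<lambda>l. l \<in> forms n 1" 0 "total_rank n d U" "Suc (Suc d * cpoly.dim (forms n d))"]
    by (meson le_imp_less_Suc)
  then show ?thesis by blast
qed

subsection \<open>Eigenvectors modulo a subspace\<close>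

text \<open>Split off a root, \<open>P = (t - \<mu>) Q\<close>, and put
  \<open>w = T v - \<mu> v\<close>, so that \<open>Q(T) w\<close> is in \<open>X\<close>. Either
  \<open>w\<close> is in \<open>X\<close> and \<open>v\<close> is the eigenvector, or the induction
  continues with \<open>w\<close> and \<open>Q\<close>.\<close>

lemma eigenvector_mod_if_poly_annihilates:
  assumes V: "cpoly.subspace V" and X: "cpoly.subspace X"
    and T_add: "\<And>f g. T (f + g) = T f + T g" and T_scale: "\<And>c f. T (Defs.smult c f) = Defs.smult c (T f)"
    and T_V: "\<And>f. f \<in> V \<Longrightarrow> T f \<in> V"
    and "v \<in> V" "v \<notin> X" "degree P \<le> N" "P \<noteq> 0"
    and "(\<Sum>i\<le>N. Defs.smult (coeff P i) ((T ^^ i) v)) \<in> X"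
  shows "\<exists>\<mu>. \<exists>w\<in>V. w \<notin> X \<and> T w - Defs.smult \<mu> w \<in> X"
  using assms(6-)
proof (induction N arbitrary: P v)
  case 0
  then obtain c where "P = [:c:]" by (auto elim: degree_eq_zeroE)
  then have "c \<noteq> 0" and "Defs.smult c v \<in> X" using 0 by auto
  from cpoly.subspace_scale[OF X this(2), of "1 / c"] show ?case using \<open>c \<noteq> 0\<close> 0 by simp
next
  case (Suc N)
  show ?case
  proof (cases "degree P = 0")
    case True
    then obtain c where c: "P = [:c:]" by (auto elim: degree_eq_zeroE)
    have sum: "(\<Sum>i\<le>Suc N. Defs.smult (coeff P i) ((T ^^ i) v)) = Defs.smult c v"
      unfolding c by (subst sum.atMost_Suc_shift) simp
    then show ?thesis
    proof -
      have "(\<Sum>i\<le>N. Defs.smult (coeff P i) ((T ^^ i) v)) = Defs.smult c v"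
        unfolding c by (subst sum.atMost_shift) simp
      then show ?thesis
        using Suc.prems sum c by (intro Suc.IH[of v P]) auto
    qed
  next
    case False
    then obtain \<mu> where "poly P \<mu> = 0"
      using fundamental_theorem_of_algebra[of P] by (auto simp: constant_degree)
    then obtain Q where Q: "P = [:- \<mu>, 1:] * Q" by (auto simp: poly_eq_0_iff_dvd dvd_def)
    have "Q \<noteq> 0" using Suc.prems(4) Q by auto
    then have "degree P = Suc (degree Q)" unfolding Q by (subst degree_mult_eq) auto
    then have deg: "degree Q \<le> N" using Suc.prems(3) by simp
    define w where "w = T v - Defs.smult \<mu> v"
    have T_diff: "T (f - g) = T f - T g" for f g
      using T_add[of "f - g" g] by simp
    have pow: "(T ^^ i) w = (T ^^ Suc i) v - Defs.smult \<mu> ((T ^^ i) v)" for i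
      by (induction i) (simp_all add: w_def T_diff T_scale)
    have "(\<Sum>i\<le>Suc N. Defs.smult (coeff P i) ((T ^^ i) v))
        = (\<Sum>i\<le>Suc N. Defs.smult (coeff (pCons 0 Q) i) ((T ^^ i) v))
          - (\<Sum>i\<le>Suc N. Defs.smult (\<mu> * coeff Q i) ((T ^^ i) v))"
      unfolding Q by (simp add: cpoly.scale_left_distrib sum.distrib sum_subtractf cpoly.scale_left_diff_distrib
          flip: sum_subtractf)
    also have "(\<Sum>i\<le>Suc N. Defs.smult (coeff (pCons 0 Q) i) ((T ^^ i) v))
        = (\<Sum>i\<le>N. Defs.smult (coeff Q i) ((T ^^ Suc i) v))"
      by (subst sum.atMost_Suc_shift) simp
    also have "(\<Sum>i\<le>Suc N. Defs.smult (\<mu> * coeff Q i) ((T ^^ i) v))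
        = (\<Sum>i\<le>N. Defs.smult (\<mu> * coeff Q i) ((T ^^ i) v))"
      using deg by (simp add: coeff_eq_0)
    also have "(\<Sum>i\<le>N. Defs.smult (coeff Q i) ((T ^^ Suc i) v))
          - (\<Sum>i\<le>N. Defs.smult (\<mu> * coeff Q i) ((T ^^ i) v))
        = (\<Sum>i\<le>N. Defs.smult (coeff Q i) ((T ^^ i) w))"
      unfolding pow by (simp add: cpoly.scale_right_diff_distrib sum_subtractf mult.commute)
    finally have "(\<Sum>i\<le>N. Defs.smult (coeff Q i) ((T ^^ i) w)) \<in> X"
      using Suc.prems(5) by simp
    moreover have "w \<in> V"
      unfolding w_def using V T_V Suc.prems(1) by (intro cpoly.subspace_diff cpoly.subspace_scale) auto
    ultimately show ?thesis
      using Suc.IH[of w Q] deg \<open>Q \<noteq> 0\<close> Suc.prems(1,2) w_def by blast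
  qed
qed

text \<open>The \<open>dim V + 1\<close> iterates \<open>v, T v, ...\<close> are linearly dependent,
  and the coefficients of a dependency form the polynomial required by
  \<open>eigenvector_mod_if_poly_annihilates\<close>.\<close>

lemma exists_eigenvector_mod:
  assumes V: "cpoly.subspace V" "V \<subseteq> forms n e" and X: "cpoly.subspace X" and "\<not> V \<subseteq> X"
    and T_add: "\<And>f g. T (f + g) = T f + T g" and T_scale: "\<And>c f. T (Defs.smult c f) = Defs.smult c (T f)"
    and T_V: "\<And>f. f \<in> V \<Longrightarrow> T f \<in> V"
  shows "\<exists>\<mu>. \<exists>w\<in>V. w \<notin> X \<and> T w - Defs.smult \<mu> w \<in> X"
proof -
  obtain v where v: "v \<in> V" "v \<notin> X" using assms(4) by blast
  define N where "N = cpoly.dim V"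
  have pow_V: "(T ^^ i) v \<in> V" for i by (induction i) (simp_all add: v(1) T_V)
  have "\<exists>c. (\<Sum>i\<le>N. const (c i) * (T ^^ i) v) = 0 \<and> \<not> (\<forall>i\<in>{..N}. c i = 0)"
  proof (rule ccontr)
    assume "\<not> ?thesis"
    then have "card {..N} \<le> cpoly.dim V"
      using pow_V V(2) by (intro card_le_dim_if_combinations_trivial[where g = "\<lambda>i. (T ^^ i) v"]) auto
    then show False by (simp add: N_def)
  qed
  then obtain c i0 where c: "(\<Sum>i\<le>N. const (c i) * (T ^^ i) v) = 0" "i0 \<le> N" "c i0 \<noteq> 0" by auto
  define P where "P = (\<Sum>i\<le>N. monom (c i) i)"
  have coeff: "coeff P i = c i" if "i \<le> N" for i
    using that by (simp add: P_def coeff_sum)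
  have "degree P \<le> N"
    unfolding P_def by (rule degree_sum_le) (auto intro: order_trans[OF degree_monom_le])
  moreover have "P \<noteq> 0" using coeff[OF c(2)] c(3) by auto
  moreover have "(\<Sum>i\<le>N. Defs.smult (coeff P i) ((T ^^ i) v)) \<in> X"
    using c(1) cpoly.subspace_0[OF X] by (simp add: coeff smult_eq_single_mult)
  ultimately show ?thesis
    using eigenvector_mod_if_poly_annihilates[OF V(1) X T_add T_scale T_V v] by blast
qed

text \<open>Choose on the monomial basis and extend linearly; the relation \<open>R\<close> respects
  linear combinations. This makes multiplication by \<open>x_i / l\<close> a linear map, although
  each quotient is determined only modulo a subspace.\<close>

lemma exists_linear_extension:
  assumes "\<And>m. m \<in> monomials n e \<Longrightarrow> \<exists>h\<in>H. R (Poly_Mapping.single m 1) h"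
    and H: "cpoly.subspace H" and R0: "R 0 0"
    and R: "\<And>f g f' g' c. R f f' \<Longrightarrow> R g g' \<Longrightarrow> R (Defs.smult c f + g) (Defs.smult c f' + g')"
  shows "\<exists>T. (\<forall>f g. T (f + g) = T f + T g) \<and> (\<forall>c f. T (Defs.smult c f) = Defs.smult c (T f))
    \<and> (\<forall>f. T f \<in> H) \<and> (\<forall>f\<in>forms n e. R f (T f))"
proof -
  obtain h where h: "\<And>m. m \<in> monomials n e \<Longrightarrow> h m \<in> H \<and> R (Poly_Mapping.single m 1) (h m)"
    using assms(1) by metis
  define T where "T f = (\<Sum>m\<in>monomials n e. Defs.smult (Poly_Mapping.lookup f m) (h m))" for f
  have add: "T (f + g) = T f + T g" for f g
    by (simp add: T_def lookup_add cpoly.scale_left_distrib sum.distrib)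
  have scale: "T (Defs.smult c f) = Defs.smult c (T f)" for c f
    by (simp add: T_def cpoly.scale_sum_right)
  have "T f \<in> H" for f
    unfolding T_def using h H by (intro cpoly.subspace_sum cpoly.subspace_scale) auto
  moreover have "R f (T f)" if "f \<in> forms n e" for f
    using that unfolding forms_eq_span
  proof (induction rule: cpoly.span_induct_alt)
    case base
    then show ?case using R0 by (simp add: T_def)
  next
    case (step c x y)
    then obtain m where m: "m \<in> monomials n e" "x = Poly_Mapping.single m 1" by blast
    have "T x = (\<Sum>m'\<in>monomials n e. if m' = m then h m else 0)"
      unfolding T_def m(2) by (intro sum.cong) (auto simp: lookup_single when_def)
    then have "T x = h m" using m(1) by (simp add: finite_monomials)
    then show ?case
      using R[of x "h m" y "T y" c] h[OF m(1)] m(2) step by (simp add: add scale)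
  qed
  ultimately show ?thesis using add scale by (intro exI[of _ T]) simp
qed

subsection \<open>The filtration by powers of a generic linear form\<close>

text \<open>The maximality of \<open>total_rank\<close> at \<open>l\<close> is recorded through its
  first-order consequence \<open>absorbs\<close>.\<close>

locale generic_linear_form =
  fixes n d k :: nat and U :: "cpoly set" and l :: cpoly
  assumes subspace_U: "cpoly.subspace U" and U_forms: "U \<subseteq> forms n d"
    and codim_U: "codim (forms n d) U = k" and k_pos: "0 < k" and k_less_d: "k < d"
    and base_point_free: "base_point_free n U" and l_forms: "l \<in> forms n 1"
    and absorbs: "\<lbrakk>e < d; p \<in> forms n (d - Suc e); l ^ Suc e * p \<in> U; m \<in> forms n 1\<rbrakk>
      \<Longrightarrow> l ^ e * m * p \<in> lspan n d U l (Suc e)"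
begin

lemma dim_forms: "cpoly.dim (forms n d) = cpoly.dim U + k"
  using codim_U dim_le_dim_forms[OF U_forms] by (simp add: codim_def)

lemma l_mult_forms: "f \<in> forms n a \<Longrightarrow> l * f \<in> forms n (Suc a)"
  using mult_in_forms[OF l_forms, of f a] by simp

text \<open>The guard \<open>e \<le> d\<close> matters for \<open>e = d + 1\<close>: truncated
  subtraction would otherwise admit constant multiples of \<open>l^(d+1)\<close>, which have the
  wrong degree. Thus \<open>Y\<close> descends from \<open>A_d\<close> at \<open>0\<close> to
  \<open>U\<close> at \<open>d + 1\<close>.\<close>

definition Y :: "nat \<Rightarrow> cpoly set" where
  "Y e = cspan (U \<union> {l ^ e * g |g. e \<le> d \<and> g \<in> forms n (d - e)})"

lemma subspace_Y [simp]: "cpoly.subspace (Y e)"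
  by (simp add: Y_def)

lemma Y_eq_lspan: "e \<le> d \<Longrightarrow> Y e = lspan n d U l e"
  unfolding Y_def lspan_def by (rule arg_cong[of _ _ cspan]) auto

lemma U_subset_Y: "U \<subseteq> Y e"
  unfolding Y_def using cpoly.span_superset[of "U \<union> {l ^ e * g |g. e \<le> d \<and> g \<in> forms n (d - e)}"] by simp

lemma power_mult_in_Y: "e \<le> d \<Longrightarrow> g \<in> forms n (d - e) \<Longrightarrow> l ^ e * g \<in> Y e"
  unfolding Y_def by (rule cpoly.span_base) blast

lemma Y_Suc_d: "Y (Suc d) = U"
  unfolding Y_def using subspace_U by simp

lemma Y_elim:
  assumes "f \<in> Y e" "e \<le> d"
  obtains u g where "u \<in> U" "g \<in> forms n (d - e)" "f = u + l ^ e * g"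
proof -
  have "\<exists>u\<in>U. \<exists>g\<in>forms n (d - e). f = u + l ^ e * g"
    using assms(1) unfolding Y_def
  proof (induction rule: cpoly.span_induct_alt)
    case base
    then show ?case
      using cpoly.subspace_0[OF subspace_U] cpoly.subspace_0[OF subspace_forms]
      by (intro bexI[of _ 0]) auto
  next
    case (step c x y)
    then obtain u g where ug: "u \<in> U" "g \<in> forms n (d - e)" "y = u + l ^ e * g" by blast
    from step(1) show ?case
    proof
      assume "x \<in> U"
      then have "Defs.smult c x + u \<in> U"
        using ug(1) subspace_U by (simp add: cpoly.subspace_add cpoly.subspace_scale)
      then show ?case using ug by (intro bexI[of _ "Defs.smult c x + u"] bexI[of _ g]) auto
    next
      assume "x \<in> {l ^ e * g |g. e \<le> d \<and> g \<in> forms n (d - e)}"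
      then obtain h where h: "h \<in> forms n (d - e)" "x = l ^ e * h" by blast
      then have "Defs.smult c h + g \<in> forms n (d - e)"
        using ug(2) subspace_forms by (simp add: cpoly.subspace_add cpoly.subspace_scale)
      then show ?case
        using ug h(2) by (intro bexI[of _ u] bexI[of _ "Defs.smult c h + g"]) (auto simp: algebra_simps)
    qed
  qed
  then show thesis using that by blast
qed

lemma Y_0: "Y 0 = forms n d"
proof
  show "Y 0 \<subseteq> forms n d"
    using lspan_in_forms[OF l_forms _ U_forms, of 0] by (simp add: Y_eq_lspan)
  show "forms n d \<subseteq> Y 0" using power_mult_in_Y[of 0] by auto
qed

lemma Y_Suc_subset: "Y (Suc e) \<subseteq> Y e"
  unfolding Y_def[of "Suc e"]
proof (intro cpoly.span_minimal subspace_Y Un_least U_subset_Y subsetI)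
  fix f assume "f \<in> {l ^ Suc e * g |g. Suc e \<le> d \<and> g \<in> forms n (d - Suc e)}"
  then obtain g where g: "f = l ^ Suc e * g" "Suc e \<le> d" "g \<in> forms n (d - Suc e)" by blast
  have "Suc (d - Suc e) = d - e" using g(2) by simp
  then have "l * g \<in> forms n (d - e)" using l_mult_forms[OF g(3)] by simp
  then show "f \<in> Y e" using power_mult_in_Y[of e "l * g"] g(1,2) by (simp add: mult_ac)
qed

lemma Y_antimono: "e \<le> e' \<Longrightarrow> Y e' \<subseteq> Y e"
  by (induction rule: dec_induct) (use Y_Suc_subset in auto)

lemma Y_forms: "Y e \<subseteq> forms n d"
  using Y_antimono[of 0 e] by (simp add: Y_0)

text \<open>\<open>J \<mu> = (U : l ^ (d - \<mu>)) + l A\<^bsub>\<mu> - 1\<^esub>\<close>; modulo \<open>l\<close> these spaces form an ideal of colength at most \<open>k\<close>.\<close>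

definition J :: "nat \<Rightarrow> cpoly set" where
  "J \<mu> = {p \<in> forms n \<mu>. l ^ (d - \<mu>) * p \<in> Y (Suc (d - \<mu>))}"

definition tau :: "nat \<Rightarrow> nat" where "tau \<mu> = codim (forms n \<mu>) (J \<mu>)"

lemma J_forms: "J \<mu> \<subseteq> forms n \<mu>"
  by (auto simp: J_def)

lemma subspace_J: "cpoly.subspace (J \<mu>)"
  unfolding cpoly.subspace_def J_def
  using subspace_forms[of n \<mu>] subspace_Y[of "Suc (d - \<mu>)"]
  by (auto simp: distrib_left cpoly.subspace_def)

text \<open>The last clause covers \<open>\<mu> = 0\<close>, where \<open>\<mu> - 1\<close>
  truncates to \<open>0\<close> and \<open>l * r\<close> could have degree \<open>1\<close>; there
  \<open>Y (Suc d) = U\<close>, and \<open>p\<close> itself serves as \<open>q\<close>.\<close>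

lemma J_elim:
  assumes "p \<in> J \<mu>" "\<mu> \<le> d"
  obtains q r where "q \<in> forms n \<mu>" "l ^ (d - \<mu>) * q \<in> U" "p = q + l * r" "r \<in> forms n (\<mu> - 1)"
    "\<mu> = 0 \<longrightarrow> r = 0"
proof (cases "\<mu> = 0")
  case True
  then show thesis using assms that[of p 0] by (auto simp: J_def Y_Suc_d forms_def)
next
  case False
  then have e: "Suc (d - \<mu>) \<le> d" "d - Suc (d - \<mu>) = \<mu> - 1" using assms(2) by auto
  obtain u g where ug: "u \<in> U" "g \<in> forms n (\<mu> - 1)" "l ^ (d - \<mu>) * p = u + l ^ Suc (d - \<mu>) * g"
    using Y_elim[of "l ^ (d - \<mu>) * p" "Suc (d - \<mu>)"] e assms(1) by (auto simp: J_def)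
  have "l * g \<in> forms n \<mu>" using l_mult_forms[OF ug(2)] False by simp
  then have "p - l * g \<in> forms n \<mu>"
    using assms(1) J_forms by (intro cpoly.subspace_diff subspace_forms) auto
  moreover have "l ^ (d - \<mu>) * (p - l * g) = u" using ug(3) by (simp add: algebra_simps)
  ultimately show thesis using that[of "p - l * g" g] ug(1,2) False by simp
qed

text \<open>Split \<open>p = q + l r\<close> with \<open>l^(d-\<mu>) q\<close> in \<open>U\<close>.
  The part \<open>q\<close> is handled by \<open>absorbs\<close>; in the part \<open>l r\<close> the
  factor \<open>l\<close> joins the power of \<open>l\<close>.\<close>

lemma var_mult_J:
  assumes "p \<in> J \<mu>" "\<mu> < d" "i < n"
  shows "var i * p \<in> J (Suc \<mu>)"
proof -
  define e where "e = d - Suc \<mu>"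
  have e: "d - \<mu> = Suc e" "d - Suc \<mu> = e" "d - Suc e = \<mu>" "e < d" using assms(2) by (auto simp: e_def)
  obtain q r where qr: "q \<in> forms n \<mu>" "l ^ Suc e * q \<in> U" "p = q + l * r" "r \<in> forms n (\<mu> - 1)"
    "\<mu> = 0 \<longrightarrow> r = 0"
    using J_elim[OF assms(1)] assms(2) e(1) by (metis less_imp_le)
  have "l ^ e * var i * q \<in> Y (Suc e)"
    using absorbs[of e q "var i"] qr(1,2) var_in_forms[OF assms(3)] e by (simp add: Y_eq_lspan)
  moreover have "l ^ Suc e * (var i * r) \<in> Y (Suc e)"
  proof (cases "\<mu> = 0")
    case True
    then show ?thesis using qr(5) cpoly.subspace_0[OF subspace_Y] by simp
  next
    case False
    then have "var i * r \<in> forms n \<mu>" using var_mult_in_forms[OF assms(3) qr(4)] by simp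
    then show ?thesis using e by (intro power_mult_in_Y) auto
  qed
  moreover have "l ^ e * (var i * p) = l ^ e * var i * q + l ^ Suc e * (var i * r)"
    unfolding qr(3) by (simp add: algebra_simps)
  ultimately have "l ^ e * (var i * p) \<in> Y (Suc e)" by (simp add: cpoly.subspace_add)
  moreover have "var i * p \<in> forms n (Suc \<mu>)"
    using var_mult_in_forms[OF assms(3)] assms(1) J_forms by blast
  ultimately show ?thesis using e by (simp add: J_def)
qed

lemma up_J: "\<mu> < d \<Longrightarrow> up n (J \<mu>) \<subseteq> J (Suc \<mu>)"
  by (rule up_subset[OF subspace_J var_mult_J])

lemma forms_mult_J:
  assumes "g \<in> forms n a" "h \<in> J \<mu>" "a + \<mu> \<le> d"
  shows "g * h \<in> J (a + \<mu>)"
  using assms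
proof (induction a arbitrary: g)
  case 0
  have "monomials n 0 \<subseteq> {0}"
  proof
    fix m assume m: "m \<in> monomials n 0"
    have "Poly_Mapping.lookup m i = 0" for i
    proof (cases "i < n")
      case False
      then have "i \<notin> Poly_Mapping.keys m" using m by (auto simp: monomials_def)
      then show ?thesis by (simp add: in_keys_iff)
    qed (use m in \<open>auto simp: monomials_def\<close>)
    then show "m \<in> {0}" by (auto intro: poly_mapping_eqI)
  qed
  then have "(\<lambda>m. Poly_Mapping.single m 1) ` monomials n 0 \<subseteq> {1 :: cpoly}" by auto
  then have "g \<in> cspan {1}" using 0(1) cpoly.span_mono unfolding forms_eq_span by blast
  then have "h * g \<in> J \<mu>"
    by (rule mult_in_subspace[OF subspace_J, rotated]) (use 0(2) in simp)
  then show ?case by (simp add: mult.commute)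
next
  case (Suc a)
  have "h * g \<in> J (Suc a + \<mu>)"
  proof (rule mult_in_subspace[OF subspace_J])
    show "g \<in> cspan {var i * f |i f. i < n \<and> f \<in> forms n a}"
      using Suc.prems(1) forms_Suc_subset_span by blast
    fix s assume "s \<in> {var i * f |i f. i < n \<and> f \<in> forms n a}"
    then obtain i f where s: "s = var i * f" "i < n" "f \<in> forms n a" by blast
    have "f * h \<in> J (a + \<mu>)" using Suc s(3) by simp
    then have "var i * (f * h) \<in> J (Suc (a + \<mu>))" using Suc.prems(3) s(2) by (intro var_mult_J) auto
    then show "h * s \<in> J (Suc a + \<mu>)" by (simp add: s(1) mult_ac)
  qed
  then show ?case by (simp add: mult.commute)
qed

text \<open>The quotients \<open>Y e / Y (Suc e)\<close> are generated by multiples of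
  \<open>l^e\<close>, from which bases are selected; their dimensions telescope to
  \<open>dim A_d - dim U\<close>.\<close>

lemma exists_adapted_basis:
  "\<exists>B. (\<forall>e\<le>d. finite (B e) \<and> B e \<subseteq> (*) (l ^ e) ` forms n (d - e) \<and> Y e \<subseteq> cspan (Y (Suc e) \<union> B e))
    \<and> (\<Sum>e\<le>d. card (B e)) = k"
proof -
  have "\<exists>B. finite B \<and> B \<subseteq> (*) (l ^ e) ` forms n (d - e) \<and> Y e \<subseteq> cspan (Y (Suc e) \<union> B)
      \<and> card B + cpoly.dim (Y (Suc e)) = cpoly.dim (Y e)" if "e \<le> d" for e
  proof -
    let ?C = "(*) (l ^ e) ` forms n (d - e)"
    have C: "?C \<subseteq> Y e" using power_mult_in_Y[OF that] by blast
    obtain B where B: "B \<subseteq> ?C" "finite B" "card B + cpoly.dim (Y (Suc e)) = cpoly.dim (Y (Suc e) \<union> ?C)"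
      "?C \<subseteq> cspan (Y (Suc e) \<union> B)"
      using complement_in_forms[OF Y_forms[of "Suc e"] subset_trans[OF C Y_forms]] by blast
    have "cspan (Y (Suc e) \<union> ?C) \<subseteq> Y e"
      using Y_Suc_subset C by (intro cpoly.span_minimal) auto
    moreover have "Y e \<subseteq> cspan (Y (Suc e) \<union> ?C)"
      unfolding Y_eq_lspan[OF that] lspan_def using U_subset_Y by (intro cpoly.span_mono) blast
    ultimately have "cspan (Y (Suc e) \<union> ?C) = Y e" by blast
    then have "cpoly.dim (Y (Suc e) \<union> ?C) = cpoly.dim (Y e)" by (metis cpoly.dim_span)
    moreover have "Y e \<subseteq> cspan (Y (Suc e) \<union> B)"
    proof -
      have "Y (Suc e) \<union> ?C \<subseteq> cspan (Y (Suc e) \<union> B)"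
        using B(4) cpoly.span_superset[of "Y (Suc e) \<union> B"] by auto
      then show ?thesis
        using \<open>cspan (Y (Suc e) \<union> ?C) = Y e\<close> cpoly.span_minimal[OF _ cpoly.subspace_span] by blast
    qed
    ultimately show ?thesis using B by auto
  qed
  then obtain B where B: "\<And>e. e \<le> d \<Longrightarrow> finite (B e) \<and> B e \<subseteq> (*) (l ^ e) ` forms n (d - e)
      \<and> Y e \<subseteq> cspan (Y (Suc e) \<union> B e) \<and> card (B e) + cpoly.dim (Y (Suc e)) = cpoly.dim (Y e)"
    by metis
  have "(\<Sum>e<m. card (B e)) + cpoly.dim (Y m) = cpoly.dim (Y 0)" if "m \<le> Suc d" for m
    using that
  proof (induction m)
    case (Suc m)
    then show ?case using B[of m] by simp
  qed simp
  from this[of "Suc d"] have "(\<Sum>e\<le>d. card (B e)) = k"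
    by (simp add: Y_Suc_d Y_0 dim_forms lessThan_Suc_atMost)
  then show ?thesis using B by (intro exI[of _ B]) auto
qed

text \<open>By the definition of \<open>J\<close>, multiplication by \<open>l^e\<close> embeds
  \<open>A_(d-e) / J (d - e)\<close> into \<open>Y e / Y (Suc e)\<close>, so the elements of
  \<open>B\<close> divided by \<open>l^e\<close> span the former.\<close>

lemma tau_le_card:
  assumes "e \<le> d" "finite B" "B \<subseteq> (*) (l ^ e) ` forms n (d - e)" "Y e \<subseteq> cspan (Y (Suc e) \<union> B)"
  shows "tau (d - e) \<le> card B"
proof -
  obtain Q where Q: "Q \<subseteq> forms n (d - e)" "B = (*) (l ^ e) ` Q" "finite Q" "card Q = card B"
    using assms(2,3) by (metis card_image finite_imageD subset_image_inj)
  have "forms n (d - e) \<subseteq> cspan (J (d - e) \<union> Q)"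
  proof
    fix p assume p: "p \<in> forms n (d - e)"
    then have "l ^ e * p \<in> cspan (Y (Suc e) \<union> B)" using power_mult_in_Y assms(1,4) by blast
    then obtain y b where yb: "y \<in> Y (Suc e)" "b \<in> cspan B" "l ^ e * p = y + b"
      unfolding cpoly.span_Un cpoly.span_eq_iff[THEN iffD2, OF subspace_Y] by blast
    have "\<exists>q\<in>cspan Q. b = l ^ e * q"
      using yb(2) unfolding Q(2)
    proof (induction rule: cpoly.span_induct_alt)
      case base
      then show ?case using cpoly.span_zero by (intro bexI[of _ 0]) auto
    next
      case (step c x y)
      then obtain q q' where "q \<in> Q" "x = l ^ e * q" "q' \<in> cspan Q" "y = l ^ e * q'" by blast
      then show ?case
        by (intro bexI[of _ "Defs.smult c q + q'"])
           (auto simp: distrib_left intro: cpoly.span_add cpoly.span_scale cpoly.span_base)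
    qed
    then obtain q where q: "q \<in> cspan Q" "b = l ^ e * q" by blast
    have "q \<in> forms n (d - e)" using q(1) Q(1) cpoly.span_minimal[OF _ subspace_forms] by blast
    then have "p - q \<in> forms n (d - e)" using p by (intro cpoly.subspace_diff subspace_forms)
    moreover have "l ^ e * (p - q) \<in> Y (Suc e)" using yb q by (simp add: right_diff_distrib)
    ultimately have "p - q \<in> J (d - e)" using assms(1) by (simp add: J_def)
    then have "p - q \<in> cspan (J (d - e) \<union> Q)" by (intro cpoly.span_base) simp
    moreover have "q \<in> cspan (J (d - e) \<union> Q)" using q(1) cpoly.span_mono[of Q "J (d - e) \<union> Q"] by auto
    ultimately have "p - q + q \<in> cspan (J (d - e) \<union> Q)" by (rule cpoly.span_add)
    then show "p \<in> cspan (J (d - e) \<union> Q)" by simp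
  qed
  from codim_forms_le_card[OF this J_forms Q(3)] show ?thesis by (simp add: tau_def Q(4))
qed

lemma sum_tau_le: "(\<Sum>\<mu>\<le>d. tau \<mu>) \<le> k"
proof -
  obtain B where B: "\<forall>e\<le>d. finite (B e) \<and> B e \<subseteq> (*) (l ^ e) ` forms n (d - e) \<and> Y e \<subseteq> cspan (Y (Suc e) \<union> B e)"
    "(\<Sum>e\<le>d. card (B e)) = k"
    using exists_adapted_basis by blast
  have "(\<Sum>\<mu>\<le>d. tau \<mu>) = (\<Sum>e\<le>d. tau (d - e))"
    by (rule sum.reindex_bij_witness[of _ "\<lambda>e. d - e" "\<lambda>e. d - e"]) auto
  also have "\<dots> \<le> (\<Sum>e\<le>d. card (B e))" using B(1) by (intro sum_mono tau_le_card) auto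
  finally show ?thesis using B(2) by simp
qed

lemma tau_Suc_eq_0:
  assumes "tau \<mu> = 0" "\<mu> < d"
  shows "tau (Suc \<mu>) = 0"
proof -
  have "forms n \<mu> \<subseteq> J \<mu>"
    using codim_eq_0_imp_forms_subset[OF subspace_J J_forms] assms(1) by (simp add: tau_def)
  then have "up n (forms n \<mu>) \<subseteq> J (Suc \<mu>)" using up_J[OF assms(2)] up_mono by blast
  then have "J (Suc \<mu>) = forms n (Suc \<mu>)" using J_forms[of "Suc \<mu>"] by (simp add: up_forms)
  then show ?thesis by (simp add: tau_def codim_def)
qed

lemma tau_eq_0_mono: "tau \<mu> = 0 \<Longrightarrow> \<mu> \<le> \<nu> \<Longrightarrow> \<nu> \<le> d \<Longrightarrow> tau \<nu> = 0"
  by (rotate_tac 1, induction rule: dec_induct) (use tau_Suc_eq_0 in auto)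

text \<open>Vanishing of \<open>tau\<close> propagates upwards, so a nonzero
  \<open>tau \<mu>\<close> means that the \<open>\<mu> + 1 > k\<close> values up to
  \<open>\<mu>\<close> are all at least \<open>1\<close>, against \<open>sum_tau_le\<close>.\<close>

lemma tau_eq_0: assumes "k \<le> \<mu>" "\<mu> \<le> d" shows "tau \<mu> = 0"
proof (rule ccontr)
  assume "tau \<mu> \<noteq> 0"
  then have "tau \<nu> \<ge> 1" if "\<nu> \<le> \<mu>" for \<nu>
    using tau_eq_0_mono[of \<nu> \<mu>] that assms(2) by (cases "tau \<nu>") auto
  then have "(\<Sum>\<nu>\<le>\<mu>. 1) \<le> (\<Sum>\<nu>\<le>\<mu>. tau \<nu>)" by (intro sum_mono) auto
  also have "\<dots> \<le> (\<Sum>\<nu>\<le>d. tau \<nu>)" using assms(2) by (intro sum_mono2) auto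
  also have "\<dots> \<le> k" by (rule sum_tau_le)
  finally show False using assms(1) by simp
qed

lemma forms_subset_J: "k \<le> \<mu> \<Longrightarrow> \<mu> \<le> d \<Longrightarrow> forms n \<mu> \<subseteq> J \<mu>"
  using codim_eq_0_imp_forms_subset[OF subspace_J J_forms] tau_eq_0 by (simp add: tau_def)

text \<open>\<open>forms_subset_J\<close> in degree \<open>d\<close>. Every class modulo
  \<open>U\<close> is represented by a multiple of \<open>l\<close> and can be divided by
  \<open>l\<close>.\<close>

lemma forms_eq_U_plus_l:
  assumes "f \<in> forms n d"
  obtains u g where "u \<in> U" "g \<in> forms n (d - 1)" "f = u + l * g"
proof -
  have "f \<in> J d" using forms_subset_J[of d] assms k_less_d by auto
  from J_elim[OF this order_refl] that show thesis by (metis diff_self_eq_0 mult_1 power_0)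
qed

text \<open>\<open>forms_subset_J\<close> in degree \<open>d - 1\<close>, in range because
  \<open>k \<le> d - 1\<close>. It permits a second division by \<open>l\<close>, which makes the
  operators \<open>x_i / l\<close> and \<open>x_j / l\<close> commute.\<close>

lemma forms_eq_colon_plus_l:
  assumes "p \<in> forms n (d - 1)"
  obtains q r where "q \<in> forms n (d - 1)" "l * q \<in> U" "r \<in> forms n (d - 2)" "p = q + l * r"
proof -
  have d: "d - (d - 1) = 1" "d - 1 - 1 = d - 2" "d - 1 \<le> d" using k_less_d by auto
  have "k \<le> d - 1" using k_less_d by simp
  then have "p \<in> J (d - 1)" using forms_subset_J[OF _ d(3)] assms by blast
  from J_elim[OF this d(3)] that show thesis by (metis d(1,2) power_one_right)
qed

end

subsection \<open>Base points from stable subspaces\<close>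

text \<open>The variables of the monomial are replaced one at a time by their scalars times
  \<open>l\<close>, which leaves its value at \<open>\<xi>\<close> times \<open>l^e\<close>.\<close>

lemma monomial_mod_stable:
  assumes S: "cpoly.subspace S" and l: "l \<in> forms n 1"
    and scalar: "\<And>i p. i < n \<Longrightarrow> p \<in> forms n (d - 1) \<Longrightarrow> var i * p - Defs.smult (\<xi> i) (l * p) \<in> S"
    and "e \<le> d" "m \<in> monomials n e" "q \<in> forms n (d - e)"
  shows "Poly_Mapping.single m 1 * q - Defs.smult (\<Prod>i<n. \<xi> i ^ Poly_Mapping.lookup m i) (l ^ e * q) \<in> S"
  using assms(4-6)
proof (induction e arbitrary: m q)
  case 0
  have "m = 0"
  proof (rule poly_mapping_eqI)
    fix i show "Poly_Mapping.lookup m i = Poly_Mapping.lookup 0 i"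
    proof (cases "i < n")
      case False
      then have "i \<notin> Poly_Mapping.keys m" using 0(2) by (auto simp: monomials_def)
      then show ?thesis by (simp add: in_keys_iff)
    qed (use 0(2) in \<open>auto simp: monomials_def\<close>)
  qed
  then show ?case using cpoly.subspace_0[OF S] by simp
next
  case (Suc e)
  obtain j m' where m: "j < n" "m' \<in> monomials n e" "m = Poly_Mapping.single j 1 + m'"
    using single_Suc_eq_var_mult[OF Suc.prems(2)] by blast
  define c where "c = (\<Prod>i<n. \<xi> i ^ Poly_Mapping.lookup m' i)"
  have prod: "(\<Prod>i<n. \<xi> i ^ Poly_Mapping.lookup m i) = \<xi> j * c"
  proof -
    have "(\<Prod>i<n. \<xi> i ^ Poly_Mapping.lookup (Poly_Mapping.single j (1::nat)) i) = (\<Prod>i<n. if i = j then \<xi> j else 1)"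
      by (intro prod.cong) (auto simp: lookup_single when_def)
    then show ?thesis using m(1) unfolding m(3) c_def
      by (simp add: lookup_add power_add prod.distrib)
  qed
  have deg: "Suc (d - Suc e) = d - e" "e + (d - Suc e) = d - 1" using Suc.prems(1) by auto
  have "Poly_Mapping.single m' 1 * (var j * q) - Defs.smult c (l ^ e * (var j * q)) \<in> S"
    unfolding c_def using Suc.IH[OF _ m(2)] var_mult_in_forms[OF m(1) Suc.prems(3)] Suc.prems(1) deg(1) by simp
  moreover have "Defs.smult c (var j * (l ^ e * q) - Defs.smult (\<xi> j) (l * (l ^ e * q))) \<in> S"
    using scalar[OF m(1)] mult_in_forms[OF power_in_forms[OF l] Suc.prems(3), of e] deg(2) S
    by (intro cpoly.subspace_scale) auto
  moreover have "Poly_Mapping.single m 1 = var j * Poly_Mapping.single m' (1::complex)"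
    by (simp add: var_def mult_single m(3))
  ultimately show ?case
    using S[THEN cpoly.subspace_add] unfolding prod
    by (fastforce simp: algebra_simps)
qed

context generic_linear_form
begin

text \<open>For \<open>S\<close> containing \<open>U\<close>, this says that \<open>x_i / l\<close>
  is well defined on \<open>A_d / S\<close>: a class is written as \<open>l q\<close>, and
  \<open>x_i q\<close> modulo \<open>S\<close> does not depend on the choice of
  \<open>q\<close>.\<close>

definition stable :: "cpoly set \<Rightarrow> bool" where
  "stable S \<longleftrightarrow> (\<forall>i<n. \<forall>q\<in>forms n (d - 1). l * q \<in> S \<longrightarrow> var i * q \<in> S)"

lemma stableD: "stable S \<Longrightarrow> i < n \<Longrightarrow> q \<in> forms n (d - 1) \<Longrightarrow> l * q \<in> S \<Longrightarrow> var i * q \<in> S"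
  by (auto simp: stable_def)

text \<open>Multiplication by \<open>var i / l\<close> is an endomorphism of \<open>A\<^bsub>d\<^esub> / S\<close>; these commute, so an eigenspace
  of one of them is stable again and, by maximality, everything.\<close>

lemma maximal_stable_scalar:
  assumes S: "cpoly.subspace S" "U \<subseteq> S" "S \<subseteq> forms n d" "S \<noteq> forms n d" "stable S"
    and max: "\<And>S'. cpoly.subspace S' \<Longrightarrow> S \<subseteq> S' \<Longrightarrow> S' \<subseteq> forms n d \<Longrightarrow> stable S' \<Longrightarrow> S' = S \<or> S' = forms n d"
    and i: "i < n"
  shows "\<exists>c. \<forall>p\<in>forms n (d - 1). var i * p - Defs.smult c (l * p) \<in> S"
proof -
  note [simp] = cpoly.subspace_add[OF S(1)] cpoly.subspace_diff[OF S(1)] cpoly.subspace_scale[OF S(1)]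
    cpoly.subspace_0[OF S(1)]
  define V where "V = forms n (d - 1)"
  \<comment> \<open>Since \<open>A_d = U + l V\<close>, multiplication by \<open>l\<close>
    identifies \<open>V / X\<close> with \<open>A_d / S\<close>; the operators are studied on
    \<open>V\<close> modulo \<open>X\<close>.\<close>
  define X where "X = {p \<in> V. l * p \<in> S}"
  have d1: "Suc (d - 1) = d" "Suc (d - 2) = d - 1" using k_pos k_less_d by auto
  have VS: "cpoly.subspace V" unfolding V_def by (rule subspace_forms)
  have XS: "cpoly.subspace X"
    using VS unfolding cpoly.subspace_def X_def by (auto simp: distrib_left)
  have lV: "l * p \<in> forms n d" "var j * p \<in> forms n d" if "p \<in> V" "j < n" for p j
    using l_mult_forms[of p "d - 1"] var_mult_in_forms[OF that(2), of p "d - 1"] that(1) d1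
    by (auto simp: V_def)
  have XX: "var j * p \<in> S" if "p \<in> X" "j < n" for j p
    using stableD[OF S(5) that(2)] that(1) by (auto simp: X_def V_def)
  have "\<not> V \<subseteq> X"
  proof
    assume "V \<subseteq> X"
    have "forms n d \<subseteq> S"
    proof
      fix f assume "f \<in> forms n d"
      then obtain u g where "u \<in> U" "g \<in> V" "f = u + l * g"
        unfolding V_def by (rule forms_eq_U_plus_l)
      moreover have "g \<in> X" using \<open>V \<subseteq> X\<close> \<open>g \<in> V\<close> by blast
      ultimately show "f \<in> S" using S(2) by (auto simp: X_def)
    qed
    then show False using S(3,4) by blast
  qed
  \<comment> \<open>\<open>R p p'\<close> expresses that the operator \<open>x_i / l\<close> on
    \<open>V / X\<close> sends \<open>p\<close> to \<open>p'\<close>.\<close>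
  define R where "R p p' \<longleftrightarrow> var i * p - l * p' \<in> S" for p p'
  have ex: "\<exists>h\<in>V. R (Poly_Mapping.single m 1) h" if "m \<in> monomials n (d - 1)" for m
  proof -
    have "var i * Poly_Mapping.single m 1 \<in> forms n d"
      using that by (intro lV(2)[OF _ i]) (auto simp: V_def forms_def)
    then obtain u g where "u \<in> U" "g \<in> V" "var i * Poly_Mapping.single m 1 = u + l * g"
      unfolding V_def by (rule forms_eq_U_plus_l)
    then show ?thesis using S(2) by (intro bexI[of _ g]) (auto simp: R_def)
  qed
  have Rlin: "R (Defs.smult c f + g) (Defs.smult c f' + g')" if "R f f'" "R g g'" for f f' g g' c
  proof -
    have "Defs.smult c (var i * f - l * f') + (var i * g - l * g') \<in> S" using that by (simp add: R_def)
    then show ?thesis by (simp add: R_def algebra_simps)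
  qed
  have "R 0 0" by (simp add: R_def)
  have "\<exists>T. (\<forall>f g. T (f + g) = T f + T g) \<and> (\<forall>c f. T (Defs.smult c f) = Defs.smult c (T f))
      \<and> (\<forall>f. T f \<in> V) \<and> (\<forall>f\<in>forms n (d - 1). R f (T f))"
    using ex VS \<open>R 0 0\<close> Rlin by (rule exists_linear_extension)
  then obtain T where "(\<forall>f g. T (f + g) = T f + T g) \<and> (\<forall>c f. T (Defs.smult c f) = Defs.smult c (T f))
      \<and> (\<forall>f. T f \<in> V) \<and> (\<forall>f\<in>forms n (d - 1). R f (T f))" ..
  then have T: "\<And>f g. T (f + g) = T f + T g" "\<And>c f. T (Defs.smult c f) = Defs.smult c (T f)"
    "\<And>f. f \<in> V \<Longrightarrow> T f \<in> V" "\<And>f. f \<in> V \<Longrightarrow> R f (T f)"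
    by (simp_all add: V_def)
  obtain c w where w: "w \<in> V" "w \<notin> X" "T w - Defs.smult c w \<in> X"
    using exists_eigenvector_mod[OF VS _ XS \<open>\<not> V \<subseteq> X\<close> T(1-3), of n "d - 1"] by (auto simp: V_def)
  have w_eig: "var i * w - Defs.smult c (l * w) \<in> S"
  proof -
    have "var i * w - l * T w \<in> S" using T(4)[OF w(1)] by (simp add: R_def)
    moreover have "l * (T w - Defs.smult c w) \<in> S" using w(3) by (simp add: X_def)
    ultimately have "(var i * w - l * T w) + l * (T w - Defs.smult c w) \<in> S" by simp
    then show ?thesis by (simp add: algebra_simps)
  qed
  \<comment> \<open>\<open>P\<close> is the eigenspace for \<open>c\<close>, lifted to
    \<open>V\<close>; \<open>S'\<close> is the corresponding subspace of \<open>A_d\<close> above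
    \<open>S\<close>.\<close>
  define P where "P = {p \<in> V. var i * p - Defs.smult c (l * p) \<in> S}"
  define S' where "S' = {y + l * p |y p. y \<in> S \<and> p \<in> P}"
  have PS: "cpoly.subspace P"
    unfolding cpoly.subspace_def P_def
  proof (intro conjI ballI allI)
    fix x y assume xy: "x \<in> {p \<in> V. var i * p - Defs.smult c (l * p) \<in> S}" "y \<in> {p \<in> V. var i * p - Defs.smult c (l * p) \<in> S}"
    then have "(var i * x - Defs.smult c (l * x)) + (var i * y - Defs.smult c (l * y)) \<in> S" by simp
    then show "x + y \<in> {p \<in> V. var i * p - Defs.smult c (l * p) \<in> S}"
      using xy VS by (simp add: cpoly.subspace_add algebra_simps)
  next
    fix a x assume x: "x \<in> {p \<in> V. var i * p - Defs.smult c (l * p) \<in> S}"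
    then have "Defs.smult a (var i * x - Defs.smult c (l * x)) \<in> S" by simp
    then show "Defs.smult a x \<in> {p \<in> V. var i * p - Defs.smult c (l * p) \<in> S}"
      using x VS by (simp add: cpoly.subspace_scale algebra_simps)
  qed (use VS in \<open>simp add: cpoly.subspace_0\<close>)
  have XP: "X \<subseteq> P" using XX[OF _ i] by (auto simp: X_def P_def)
  have "S' = S \<or> S' = forms n d"
  proof (rule max)
    have "S' = {x + y |x y. x \<in> S \<and> y \<in> (*) l ` P}" unfolding S'_def by blast
    moreover have "cpoly.subspace ((*) l ` P)"
      unfolding cpoly.subspace_def
    proof (intro conjI ballI allI)
      show "0 \<in> (*) l ` P" using cpoly.subspace_0[OF PS] by force
      fix x y assume "x \<in> (*) l ` P" "y \<in> (*) l ` P"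
      then show "x + y \<in> (*) l ` P"
        using cpoly.subspace_add[OF PS] by (auto simp flip: distrib_left)
    next
      fix a x assume "x \<in> (*) l ` P"
      then obtain p where "p \<in> P" "x = l * p" by blast
      then show "Defs.smult a x \<in> (*) l ` P"
        using cpoly.subspace_scale[OF PS, of p a] by (intro image_eqI[of _ _ "Defs.smult a p"]) simp_all
    qed
    ultimately show "cpoly.subspace S'" using cpoly.subspace_sums[OF S(1)] by simp
    show "S \<subseteq> S'" using cpoly.subspace_0[OF PS] by (force simp: S'_def)
    show "S' \<subseteq> forms n d"
      using S(3) lV(1)[OF _ i] by (auto simp: S'_def P_def intro!: cpoly.subspace_add[OF subspace_forms])
    show "stable S'"
      unfolding stable_def
    proof (intro allI ballI impI)
      fix j q assume j: "j < n" and q: "q \<in> forms n (d - 1)" "l * q \<in> S'"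
      then obtain y p where yp: "y \<in> S" "p \<in> P" "l * q = y + l * p" by (auto simp: S'_def)
      have "q - p \<in> X"
        using yp q(1) VS by (auto simp: X_def P_def V_def right_diff_distrib intro: cpoly.subspace_diff)
      then have qp: "var j * (q - p) \<in> S" using XX j by blast
      have "p \<in> V" using yp(2) by (simp add: P_def)
      \<comment> \<open>Modulo \<open>X\<close> the element \<open>p\<close> is \<open>l r\<close>,
        so \<open>x_j / l\<close> sends it to \<open>x_j r\<close>. That \<open>x_j r\<close> is
        again in \<open>P\<close> is the commutation with \<open>x_i / l\<close>.\<close>
      obtain z r where zr: "z \<in> X" "r \<in> forms n (d - 2)" "p = z + l * r"
      proof -
        obtain z r where "z \<in> forms n (d - 1)" "l * z \<in> U" "r \<in> forms n (d - 2)" "p = z + l * r"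
          by (rule forms_eq_colon_plus_l[OF \<open>p \<in> V\<close>[unfolded V_def]])
        then show thesis using that[of z r] S(2) by (auto simp: X_def V_def)
      qed
      have jr: "var j * r \<in> P"
      proof -
        have rV: "var j * r \<in> V" "l * r \<in> V" "var i * r \<in> V"
          using var_mult_in_forms[OF j zr(2)] var_mult_in_forms[OF i zr(2)] l_mult_forms[OF zr(2)] d1
          by (auto simp: V_def)
        have "l * (var i * r - Defs.smult c (l * r)) \<in> S"
        proof -
          have "var i * (p - z) - Defs.smult c (l * (p - z)) \<in> S"
            using PS yp(2) zr(1) XP cpoly.subspace_diff[OF PS, of p z] by (auto simp: P_def)
          then show ?thesis by (simp add: zr(3) algebra_simps)
        qed
        then have "var i * r - Defs.smult c (l * r) \<in> X"
          using rV VS by (auto simp: X_def intro: cpoly.subspace_diff cpoly.subspace_scale)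
        then have "var j * (var i * r - Defs.smult c (l * r)) \<in> S" using XX j by blast
        then show ?thesis using rV by (simp add: P_def algebra_simps)
      qed
      have "var j * (q - p) + var j * z \<in> S"
        using qp XX[OF zr(1) j] by (rule cpoly.subspace_add[OF S(1)])
      moreover have "var j * q = (var j * (q - p) + var j * z) + l * (var j * r)"
        by (simp add: zr(3) algebra_simps)
      ultimately show "var j * q \<in> S'" using jr unfolding S'_def by blast
    qed
  qed
  \<comment> \<open>The eigenvector makes \<open>S'\<close> strictly larger than \<open>S\<close>,
    so maximality leaves only \<open>S' = A_d\<close>.\<close>
  moreover have "l * w \<in> S'"
    unfolding S'_def using w(1) w_eig by (intro CollectI exI[of _ 0] exI[of _ w]) (simp add: P_def)
  moreover have "l * w \<notin> S" using w(1,2) by (simp add: X_def)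
  ultimately have full: "S' = forms n d" by blast
  have "var i * p - Defs.smult c (l * p) \<in> S" if p: "p \<in> V" for p
  proof -
    have "l * p \<in> S'" using lV(1)[OF p i] full by simp
    then obtain y q where yq: "y \<in> S" "q \<in> P" "l * p = y + l * q" by (auto simp: S'_def)
    then have "p - q \<in> X"
      using p VS by (auto simp: X_def P_def right_diff_distrib intro: cpoly.subspace_diff)
    then have "p - q + q \<in> P" using XP yq(2) cpoly.subspace_add[OF PS] by blast
    then show ?thesis by (simp add: P_def)
  qed
  then show ?thesis by (auto simp: V_def)
qed

text \<open>Take a proper stable \<open>M\<close> containing \<open>U\<close> of largest dimension.
  Every \<open>x_i / l\<close> acts modulo \<open>M\<close> as a scalar \<open>\<xi> i\<close>, so
  each form \<open>f\<close> of degree \<open>d\<close> is congruent to \<open>f(\<xi>) l^d\<close>.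
  As \<open>M\<close> is proper, it does not contain \<open>l^d\<close>; hence the elements of
  \<open>U\<close>, lying in \<open>M\<close>, vanish at \<open>\<xi>\<close>, a base point.\<close>

lemma not_stable:
  assumes S: "cpoly.subspace S" "U \<subseteq> S" "S \<subseteq> forms n d" "S \<noteq> forms n d"
  shows "\<not> stable S"
proof
  assume "stable S"
  define Q where "Q S' \<longleftrightarrow> cpoly.subspace S' \<and> U \<subseteq> S' \<and> S' \<subseteq> forms n d \<and> S' \<noteq> forms n d \<and> stable S'" for S'
  have "Q S" using S \<open>stable S\<close> by (simp add: Q_def)
  then obtain M where M: "Q M" "\<And>S'. Q S' \<Longrightarrow> cpoly.dim S' \<le> cpoly.dim M"
    using ex_has_greatest_nat[of Q S cpoly.dim "Suc (cpoly.dim (forms n d))"]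
    by (metis Q_def dim_le_dim_forms le_imp_less_Suc)
  then have M': "cpoly.subspace M" "U \<subseteq> M" "M \<subseteq> forms n d" "M \<noteq> forms n d" "stable M" by (auto simp: Q_def)
  have "\<exists>c. \<forall>p\<in>forms n (d - 1). var i * p - Defs.smult c (l * p) \<in> M" if "i < n" for i
  proof (rule maximal_stable_scalar[OF M' _ that])
    fix S' assume S': "cpoly.subspace S'" "M \<subseteq> S'" "S' \<subseteq> forms n d" "stable S'"
    show "S' = M \<or> S' = forms n d"
    proof (cases "S' = forms n d")
      case False
      then have "Q S'" using S' M' by (auto simp: Q_def)
      then have "S' \<subseteq> M" using forms_subset_if_dim_le[OF M'(1) S'(2,3)] M(2) by blast
      then show ?thesis using S'(2) by blast
    qed simp
  qed
  then obtain \<xi> where \<xi>: "\<And>i p. i < n \<Longrightarrow> p \<in> forms n (d - 1) \<Longrightarrow> var i * p - Defs.smult (\<xi> i) (l * p) \<in> M"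
    by metis
  have mono: "Poly_Mapping.single m 1 - Defs.smult (\<Prod>i<n. \<xi> i ^ Poly_Mapping.lookup m i) (l ^ d) \<in> M"
    if "m \<in> monomials n d" for m
  proof -
    have "1 \<in> forms n (d - d)" by (auto simp: forms_def monomials_def simp flip: single_one)
    from monomial_mod_stable[OF M'(1) l_forms \<xi> order_refl that this] show ?thesis by simp
  qed
  have eval: "f - Defs.smult (eval n \<xi> f) (l ^ d) \<in> M" if f: "f \<in> forms n d" for f
  proof -
    let ?c = "\<lambda>m. \<Prod>i<n. \<xi> i ^ Poly_Mapping.lookup m i"
    have f_sum: "f = (\<Sum>m\<in>Poly_Mapping.keys f. Defs.smult (Poly_Mapping.lookup f m) (Poly_Mapping.single m 1))"
      by (intro poly_mapping_eqI) (simp add: lookup_sum lookup_single when_def in_keys_iff if_distrib cong: if_cong)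
    have "f - Defs.smult (eval n \<xi> f) (l ^ d)
      = (\<Sum>m\<in>Poly_Mapping.keys f. Defs.smult (Poly_Mapping.lookup f m) (Poly_Mapping.single m 1 - Defs.smult (?c m) (l ^ d)))"
      by (subst (1) f_sum) (simp add: eval_def cpoly.scale_sum_left sum_subtractf cpoly.scale_right_diff_distrib)
    also have "\<dots> \<in> M"
      using f mono M'(1) by (intro cpoly.subspace_sum cpoly.subspace_scale) (auto simp: forms_def)
    finally show ?thesis .
  qed
  have "l ^ d \<notin> M"
  proof
    assume "l ^ d \<in> M"
    then have "f \<in> M" if "f \<in> forms n d" for f
      using cpoly.subspace_add[OF M'(1) eval[OF that] cpoly.subspace_scale[OF M'(1), of "l ^ d" "eval n \<xi> f"]] by simp
    then show False using M'(3,4) by blast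
  qed
  have "eval n \<xi> f = 0" if "f \<in> U" for f
  proof (rule ccontr)
    assume "eval n \<xi> f \<noteq> 0"
    have "f - (f - Defs.smult (eval n \<xi> f) (l ^ d)) \<in> M"
      using that U_forms M'(2) by (intro cpoly.subspace_diff[OF M'(1)] eval) auto
    then have "Defs.smult (eval n \<xi> f) (l ^ d) \<in> M" by simp
    from cpoly.subspace_scale[OF M'(1) this, of "1 / eval n \<xi> f"]
    show False using \<open>l ^ d \<notin> M\<close> \<open>eval n \<xi> f \<noteq> 0\<close> by simp
  qed
  \<comment> \<open>If all \<open>\<xi> i\<close> were zero, \<open>A_1 A_(d-1)\<close>, which is
    \<open>A_d\<close>, would lie in \<open>M\<close>.\<close>
  moreover have "\<exists>i<n. \<xi> i \<noteq> 0"
  proof (rule ccontr)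
    assume "\<not> ?thesis"
    then have "var i * p \<in> M" if "i < n" "p \<in> forms n (d - 1)" for i p
      using \<xi>[OF that] that(1) by simp
    then have "up n (forms n (d - 1)) \<subseteq> M" by (intro up_subset[OF M'(1)])
    moreover have "Suc (d - 1) = d" using k_less_d by simp
    ultimately have "forms n d \<subseteq> M" by (simp add: up_forms)
    then show False using M'(3,4) by blast
  qed
  ultimately show False using base_point_free by (auto simp: base_point_free_def)
qed

end

subsection \<open>Levels\<close>

lemma choose_two_add: "(a + b) choose 2 = (a choose 2) + a * b + (b choose 2)"
  by (induction b) (simp_all add: numeral_2_eq_2)

text \<open>The arithmetic of one step of \<open>level_products\<close>: \<open>a = D i\<close>,
  \<open>b = D (i + 1) - D i\<close> bounds the number of new elements, and \<open>s\<close>, the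
  sum of \<open>D j\<close> over \<open>j \<le> i + 1\<close>, the cost of each.\<close>

lemma choose_three_add_ge:
  assumes "s \<le> (Suc a choose 2) + a + b"
  shows "((a + 2) choose 3) + b * s \<le> (a + b + 2) choose 3"
proof -
  have "((a + 2) choose 3) + b * ((Suc a choose 2) + a + b) \<le> (a + b + 2) choose 3"
  proof (induction b)
    case (Suc b)
    have "(Suc a choose 2) + a + 2 * b + 1 \<le> (Suc a + Suc b) choose 2"
      unfolding choose_two_add[of "Suc a"] by (simp add: numeral_2_eq_2)
    moreover have "(a + Suc b + 2) choose 3 = ((a + b + 2) choose 3) + ((Suc a + Suc b) choose 2)"
      by (simp add: numeral_3_eq_3 numeral_2_eq_2)
    ultimately show ?case using Suc by (simp add: algebra_simps)
  qed simp
  moreover have "b * s \<le> b * ((Suc a choose 2) + a + b)" using assms by simp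
  ultimately show ?thesis by linarith
qed

text \<open>Pairs in a union of disjoint blocks of sizes \<open>t i\<close> either meet two blocks
  or lie in one.\<close>

lemma sum_choose_two:
  fixes t :: "nat \<Rightarrow> nat"
  shows "(\<Sum>\<nu><m. t \<nu> * (\<Sum>i<\<nu>. t i) + (t \<nu> choose 2)) = (\<Sum>i<m. t i) choose 2"
  by (induction m) (simp_all add: choose_two_add mult.commute)

lemma card_products_le:
  fixes V :: "'a :: ab_semigroup_mult set"
  assumes "finite V"
  shows "finite {v * w |v w. v \<in> V \<and> w \<in> V} \<and> card {v * w |v w. v \<in> V \<and> w \<in> V} \<le> Suc (card V) choose 2"
  using assms
proof (induction V)
  case (insert x V)
  let ?P = "{v * w |v w. v \<in> V \<and> w \<in> V}"
  have eq: "{v * w |v w. v \<in> insert x V \<and> w \<in> insert x V} = ?P \<union> (*) x ` insert x V"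
    by (auto simp: mult.commute)
  have "card ((*) x ` insert x V) \<le> Suc (card V)"
    using card_image_le[of "insert x V" "(*) x"] insert.hyps by simp
  then have "card (?P \<union> (*) x ` insert x V) \<le> (Suc (card V) choose 2) + Suc (card V)"
    using insert.IH card_Un_le[of ?P "(*) x ` insert x V"] by linarith
  then show ?case
    unfolding eq using insert by (simp add: numeral_2_eq_2)
qed simp

section \<open>The levels \<open>U_i\<close> of the overview and their growth\<close>

context generic_linear_form
begin

primrec lev :: "nat \<Rightarrow> cpoly set" where
  "lev 0 = U"
| "lev (Suc i) = cspan (U \<union> {var j * q |j q. j < n \<and> q \<in> forms n (d - 1) \<and> l * q \<in> lev i})"

definition D :: "nat \<Rightarrow> nat" where "D i = cpoly.dim (lev i) - cpoly.dim U"

lemma d1: "Suc (d - 1) = d" "Suc (d - Suc 0) = d"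
  using k_less_d by auto

lemma subspace_lev: "cpoly.subspace (lev i)"
  by (cases i) (simp_all add: subspace_U)

lemma U_subset_lev: "U \<subseteq> lev i"
  by (cases i) (auto intro: cpoly.span_base)

lemma var_mult_in_lev: "j < n \<Longrightarrow> q \<in> forms n (d - 1) \<Longrightarrow> l * q \<in> lev i \<Longrightarrow> var j * q \<in> lev (Suc i)"
  by (auto intro!: cpoly.span_base)

lemma lev_forms: "lev i \<subseteq> forms n d"
proof (cases i)
  case (Suc i')
  show ?thesis
    unfolding Suc lev.simps using U_forms var_mult_in_forms[of _ n _ "d - 1"] d1
    by (intro cpoly.span_minimal subspace_forms) auto
qed (simp add: U_forms)

lemma lev_Suc: "lev i \<subseteq> lev (Suc i)"
proof (induction i)
  case (Suc i)
  then show ?case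
    unfolding lev.simps(2)[of "Suc i"] unfolding lev.simps(2)[of i]
    by (intro cpoly.span_mono) (auto simp del: lev.simps)
qed (auto intro: cpoly.span_base)

lemma dim_lev: "cpoly.dim (lev i) = cpoly.dim U + D i"
  using dim_mono_forms[OF subset_trans[OF U_subset_lev cpoly.span_superset] lev_forms, of i]
  by (simp add: D_def)

lemma D_le: "D i \<le> k"
  using dim_le_dim_forms[OF lev_forms, of i] by (simp add: dim_forms dim_lev)

lemma D_0: "D 0 = 0"
  by (simp add: D_def)

text \<open>A repeated level would be \<open>stable\<close>, which \<open>not_stable\<close>
  excludes for a proper subspace.\<close>

lemma D_less:
  assumes "D i < k"
  shows "D i < D (Suc i)"
proof (rule ccontr)
  assume "\<not> D i < D (Suc i)"
  then have "lev (Suc i) \<subseteq> lev i"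
    using forms_subset_if_dim_le[OF subspace_lev lev_Suc lev_forms, of i] by (simp only: dim_lev)
  then have "stable (lev i)" using var_mult_in_lev by (auto simp: stable_def simp del: lev.simps)
  moreover have "lev i \<noteq> forms n d" using assms dim_lev[of i] dim_forms by auto
  ultimately show False using not_stable[OF subspace_lev U_subset_lev lev_forms] by blast
qed

lemma D_mono: "D i \<le> D (Suc i)"
  using dim_mono_forms[OF subset_trans[OF lev_Suc cpoly.span_superset] lev_forms, of i]
  by (simp only: dim_lev)

lemma D_ge: "i \<le> k \<Longrightarrow> i \<le> D i"
proof (induction i)
  case (Suc i)
  show ?case
  proof (cases "D i < k")
    case True
    then show ?thesis using D_less[OF True] Suc by simp
  next
    case False
    then have "D i = k" using D_le[of i] by simp
    then show ?thesis using Suc.prems D_mono[of i] by simp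
  qed
qed simp

lemma lev_k: "lev k = forms n d"
proof -
  have "D k = k" using D_le[of k] D_ge[of k] by simp
  then have "cpoly.dim (forms n d) \<le> cpoly.dim (lev k)" by (simp add: dim_forms dim_lev)
  from forms_subset_if_dim_le[OF subspace_lev lev_forms order_refl this] lev_forms show ?thesis by blast
qed

text \<open>Up to \<open>i\<close> the values of \<open>D\<close> increase strictly, so they are
  distinct numbers not exceeding \<open>D i\<close>, and \<open>0 + 1 + ... + D i\<close> bounds
  their sum.\<close>

lemma sum_D_le: "D i < k \<Longrightarrow> (\<Sum>j\<le>i. D j) \<le> Suc (D i) choose 2"
proof (induction i)
  case (Suc i)
  then have "D i < k" using D_mono[of i] by simp
  then have "Suc (D i) choose 2 \<le> D (Suc i) choose 2" using D_less[of i] by (intro binomial_right_mono) simp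
  then show ?case using Suc.IH[OF \<open>D i < k\<close>] by (simp add: numeral_2_eq_2)
qed (simp add: D_0)

text \<open>Unlike in \<open>lev\<close>, elements arise by single quotients and not by linear
  combinations, so that the steps can be undone one by one in \<open>chain_mult\<close>. The
  correction \<open>u\<close> allows a representative divisible by \<open>l\<close> to be chosen
  before the next step.\<close>

primrec chain :: "nat \<Rightarrow> cpoly set" where
  "chain 0 = U"
| "chain (Suc i) = {var j * q - u |j q u. j < n \<and> q \<in> forms n (d - 1) \<and> l * q \<in> chain i \<and> u \<in> U}"

lemma chain_SucI:
  "j < n \<Longrightarrow> q \<in> forms n (d - 1) \<Longrightarrow> l * q \<in> chain i \<Longrightarrow> var j * q \<in> chain (Suc i)"
  unfolding chain.simps using cpoly.subspace_0[OF subspace_U]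
  by (intro CollectI exI[of _ j] exI[of _ q] exI[of _ 0]) simp

lemma chain_diff: "x \<in> chain (Suc i) \<Longrightarrow> u \<in> U \<Longrightarrow> x - u \<in> chain (Suc i)"
  using cpoly.subspace_add[OF subspace_U] by (fastforce simp: diff_diff_eq)

lemma chain_subset_lev: "chain i \<subseteq> lev i"
proof (induction i)
  case (Suc i)
  show ?case
  proof
    fix x assume "x \<in> chain (Suc i)"
    then obtain j q u where x: "x = var j * q - u" "j < n" "q \<in> forms n (d - 1)" "l * q \<in> chain i" "u \<in> U"
      by auto
    then have "var j * q \<in> lev (Suc i)" using Suc by (intro var_mult_in_lev) auto
    then show "x \<in> lev (Suc i)"
      using x(1,5) U_subset_lev by (auto intro: cpoly.subspace_diff[OF subspace_lev] simp del: lev.simps)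
  qed
qed simp

text \<open>A chain element is \<open>u + l g\<close> by \<open>forms_eq_U_plus_l\<close>, and
  \<open>l g\<close> is still in the chain, so each \<open>x_j g\<close> is in the next one. Linear
  combinations inherit such a decomposition.\<close>

lemma span_chain_decompose:
  assumes "f \<in> cspan (lev i \<union> chain (Suc i))"
  shows "\<exists>y\<in>lev i. \<exists>r\<in>forms n (d - 1). f = y + l * r \<and> (\<forall>j<n. var j * r \<in> cspan (chain (Suc (Suc i))))"
  using assms
proof (induction rule: cpoly.span_induct_alt)
  case base
  then show ?case
    using cpoly.subspace_0[OF subspace_lev] cpoly.subspace_0[OF subspace_forms] cpoly.span_zero
    by (intro bexI[of _ 0]) auto
next
  case (step c x f)
  then obtain y r where yr: "y \<in> lev i" "r \<in> forms n (d - 1)" "f = y + l * r"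
    "\<And>j. j < n \<Longrightarrow> var j * r \<in> cspan (chain (Suc (Suc i)))" by blast
  from step(1) show ?case
  proof
    assume "x \<in> lev i"
    then have "Defs.smult c x + y \<in> lev i"
      using yr(1) subspace_lev by (intro cpoly.subspace_add cpoly.subspace_scale)
    then show ?case using yr by (intro bexI[of _ "Defs.smult c x + y"] bexI[of _ r]) auto
  next
    assume x: "x \<in> chain (Suc i)"
    then have "x \<in> forms n d" using chain_subset_lev lev_forms by blast
    then obtain u g where ug: "u \<in> U" "g \<in> forms n (d - 1)" "x = u + l * g"
      by (rule forms_eq_U_plus_l)
    have "l * g \<in> chain (Suc i)" using chain_diff[OF x ug(1)] ug(3) by simp
    then have g: "var j * g \<in> cspan (chain (Suc (Suc i)))" if "j < n" for j
      using chain_SucI[OF that ug(2)] by (intro cpoly.span_base)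
    have "Defs.smult c u + y \<in> lev i"
      using yr(1) ug(1) U_subset_lev subspace_lev by (intro cpoly.subspace_add cpoly.subspace_scale) auto
    moreover have "Defs.smult c g + r \<in> forms n (d - 1)"
      using yr(2) ug(2) by (intro cpoly.subspace_add cpoly.subspace_scale subspace_forms)
    moreover have "Defs.smult c x + f = (Defs.smult c u + y) + l * (Defs.smult c g + r)"
      by (simp add: ug(3) yr(3) algebra_simps)
    moreover have "var j * (Defs.smult c g + r) \<in> cspan (chain (Suc (Suc i)))" if "j < n" for j
      using g[OF that] yr(4)[OF that] by (simp add: distrib_left cpoly.span_add cpoly.span_scale)
    ultimately show ?case by blast
  qed
qed

text \<open>Decompose \<open>l q = y + l r\<close> by \<open>span_chain_decompose\<close> and write
  \<open>x_j q = x_j (q - r) + x_j r\<close>. Since \<open>l (q - r) = y\<close> is one level lower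
  than \<open>l q\<close>, the first term is in the level already reached, and the second is in the
  span of the chain.\<close>

lemma lev_Suc_subset_span_chain: "lev (Suc i) \<subseteq> cspan (lev i \<union> chain (Suc i))"
proof (induction i)
  case 0
  have "U \<union> {var j * q |j q. j < n \<and> q \<in> forms n (d - 1) \<and> l * q \<in> U} \<subseteq> lev 0 \<union> chain (Suc 0)"
    using chain_SucI[of _ _ 0] by auto
  then show ?case by (simp add: cpoly.span_mono)
next
  case (Suc i)
  let ?T = "cspan (lev (Suc i) \<union> chain (Suc (Suc i)))"
  have base: "lev (Suc i) \<subseteq> ?T" "cspan (chain (Suc (Suc i))) \<subseteq> ?T"
    using cpoly.span_superset[of "lev (Suc i) \<union> chain (Suc (Suc i))"]
      cpoly.span_mono[of "chain (Suc (Suc i))" "lev (Suc i) \<union> chain (Suc (Suc i))"] by auto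
  have "var j * q \<in> ?T" if jq: "j < n" "q \<in> forms n (d - 1)" "l * q \<in> lev (Suc i)" for j q
  proof -
    obtain y r where yr: "y \<in> lev i" "r \<in> forms n (d - 1)" "l * q = y + l * r"
      "var j * r \<in> cspan (chain (Suc (Suc i)))"
      using span_chain_decompose[of "l * q" i] Suc jq by blast
    have "l * (q - r) \<in> lev i" using yr(1,3) by (simp add: right_diff_distrib)
    moreover have "q - r \<in> forms n (d - 1)" using jq(2) yr(2) by (rule cpoly.subspace_diff[OF subspace_forms])
    ultimately have "var j * (q - r) \<in> lev (Suc i)" by (intro var_mult_in_lev jq(1))
    then have "var j * (q - r) + var j * r \<in> ?T" using base yr(4) by (intro cpoly.span_add) auto
    then show ?thesis by (simp add: right_diff_distrib)
  qed
  moreover have "U \<subseteq> ?T" using U_subset_lev base(1) by blast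
  ultimately show ?case
    unfolding lev.simps(2)[of "Suc i"] by (intro cpoly.span_minimal cpoly.subspace_span) auto
qed

section \<open>Products modulo the span of \<open>U^2\<close>\<close>

abbreviation SQ :: "cpoly set" where "SQ \<equiv> square_span U"

lemma in_SQ: "f \<in> U \<Longrightarrow> g \<in> U \<Longrightarrow> f * g \<in> SQ"
  unfolding square_span_def by (rule cpoly.span_base) blast

text \<open>\<open>v U\<close> lies in \<open>SQ\<close>, so only the products of \<open>v\<close>
  with a complement of \<open>U\<close> in \<open>lev s\<close> count.\<close>

lemma U_mult_lev:
  assumes "v \<in> U"
  obtains F where "finite F" "card F \<le> D s" "\<And>f. f \<in> lev s \<Longrightarrow> v * f \<in> cspan (SQ \<union> F)"
proof -
  obtain B where B: "B \<subseteq> lev s" "finite B" "card B + cpoly.dim U = cpoly.dim (U \<union> lev s)"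
    "lev s \<subseteq> cspan (U \<union> B)"
    by (rule complement_in_forms[OF U_forms lev_forms])
  have "U \<union> lev s = lev s" using U_subset_lev by blast
  then have "card B = D s" using B(3) dim_lev[of s] by simp
  moreover have "v * f \<in> cspan (SQ \<union> (*) v ` B)" if "f \<in> lev s" for f
  proof (rule mult_in_subspace[OF cpoly.subspace_span])
    show "f \<in> cspan (U \<union> B)" using that B(4) by blast
    show "v * b \<in> cspan (SQ \<union> (*) v ` B)" if "b \<in> U \<union> B" for b
      using that in_SQ[OF assms] by (auto intro: cpoly.span_base)
  qed
  ultimately show thesis using that[of "(*) v ` B"] B(2) card_image_le[OF B(2), of "(*) v"] by simp
qed

text \<open>Undo a step \<open>v = x_j q - u\<close> by exchanging \<open>x_j\<close> for
  \<open>l\<close> between the factors: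
  \<open>v l^(i+1) x = (l q) (l^i x_j x) - u l^(i+1) x\<close>. The first factor drops one chain
  step while the second rises from \<open>lev s\<close> to \<open>lev (s + 1)\<close>, hence the
  general \<open>s\<close>; the term with \<open>u\<close> costs \<open>D s\<close> by
  \<open>U_mult_lev\<close>.\<close>

lemma chain_mult:
  assumes "v \<in> chain i" "i \<le> d"
  shows "\<exists>F. finite F \<and> card F \<le> (\<Sum>j=s..s+i. D j) \<and>
    (\<forall>x\<in>forms n (d - i). l ^ i * x \<in> lev s \<longrightarrow> v * (l ^ i * x) \<in> cspan (SQ \<union> F))"
  using assms
proof (induction i arbitrary: v s)
  case 0
  then obtain F where "finite F" "card F \<le> D s" "\<And>f. f \<in> lev s \<Longrightarrow> v * f \<in> cspan (SQ \<union> F)"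
    using U_mult_lev[of v s] by auto
  then show ?case by (intro exI[of _ F]) auto
next
  case (Suc i)
  obtain j q u where v: "v = var j * q - u" "j < n" "q \<in> forms n (d - 1)" "l * q \<in> chain i" "u \<in> U"
    using Suc.prems(1) by auto
  obtain F1 where F1: "finite F1" "card F1 \<le> (\<Sum>j=Suc s..Suc s+i. D j)"
    "\<And>x. x \<in> forms n (d - i) \<Longrightarrow> l ^ i * x \<in> lev (Suc s) \<Longrightarrow> (l * q) * (l ^ i * x) \<in> cspan (SQ \<union> F1)"
    using Suc.IH[OF v(4), of "Suc s"] Suc.prems(2) by (auto simp del: lev.simps)
  obtain F0 where F0: "finite F0" "card F0 \<le> D s" "\<And>f. f \<in> lev s \<Longrightarrow> u * f \<in> cspan (SQ \<union> F0)"
    using U_mult_lev[OF v(5), of s] by blast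
  have "v * (l ^ Suc i * x) \<in> cspan (SQ \<union> (F0 \<union> F1))"
    if x: "x \<in> forms n (d - Suc i)" "l ^ Suc i * x \<in> lev s" for x
  proof -
    have "l ^ i * x \<in> forms n (d - 1)"
      using mult_in_forms[OF power_in_forms[OF l_forms, of i] x(1)] Suc.prems(2) by simp
    then have "var j * (l ^ i * x) \<in> lev (Suc s)"
      using x(2) v(2) by (intro var_mult_in_lev) (simp_all add: mult.assoc)
    then have lev: "l ^ i * (var j * x) \<in> lev (Suc s)" by (simp add: mult.left_commute del: lev.simps)
    have "Suc (d - Suc i) = d - i" using Suc.prems(2) by simp
    then have "var j * x \<in> forms n (d - i)" using var_mult_in_forms[OF v(2) x(1)] by simp
    from F1(3)[OF this lev] F0(3)[OF x(2)]
    have "(l * q) * (l ^ i * (var j * x)) \<in> cspan (SQ \<union> (F0 \<union> F1))"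
      "u * (l ^ Suc i * x) \<in> cspan (SQ \<union> (F0 \<union> F1))"
      using cpoly.span_mono[of "SQ \<union> F1" "SQ \<union> (F0 \<union> F1)"] cpoly.span_mono[of "SQ \<union> F0" "SQ \<union> (F0 \<union> F1)"]
      by blast+
    from cpoly.span_diff[OF this] show ?thesis by (simp add: v(1) algebra_simps)
  qed
  moreover have "card (F0 \<union> F1) \<le> (\<Sum>j=s..s+Suc i. D j)"
    using card_Un_le[of F0 F1] F0(2) F1(2) by (simp add: sum.atLeast_Suc_atMost del: sum.cl_ivl_Suc)
  ultimately show ?case using F0(1) F1(1) by (intro exI[of _ "F0 \<union> F1"]) blast
qed

text \<open>Only a complement \<open>B\<close> of \<open>lev i\<close> in
  \<open>lev (i + 1)\<close>, taken from \<open>chain (i + 1)\<close>, is new, each element at the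
  cost given by \<open>chain_mult\<close>. On \<open>lev i\<close> itself,
  \<open>l^(i+1) p = l^i (l p)\<close> reduces to the previous stage.\<close>

lemma level_products:
  assumes "i \<le> k"
  shows "\<exists>F. finite F \<and> card F \<le> (D i + 2) choose 3 \<and>
    (\<forall>j\<le>i. \<forall>f\<in>lev j. \<forall>p\<in>forms n (d - j). l ^ j * p \<in> U \<longrightarrow> (l ^ j * p) * f \<in> cspan (SQ \<union> F))"
  using assms
proof (induction i)
  case 0
  show ?case
    using in_SQ by (intro exI[of _ "{}"]) (auto intro: cpoly.span_base)
next
  case (Suc i)
  obtain F where F: "finite F" "card F \<le> (D i + 2) choose 3"
    "\<And>j f p. j \<le> i \<Longrightarrow> f \<in> lev j \<Longrightarrow> p \<in> forms n (d - j) \<Longrightarrow> l ^ j * p \<in> U \<Longrightarrow> (l ^ j * p) * f \<in> cspan (SQ \<union> F)"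
    using Suc by (auto simp del: lev.simps)
  have "chain (Suc i) \<subseteq> forms n d" using chain_subset_lev lev_forms by blast
  then obtain B where B: "B \<subseteq> chain (Suc i)" "finite B"
    "card B + cpoly.dim (lev i) = cpoly.dim (lev i \<union> chain (Suc i))" "chain (Suc i) \<subseteq> cspan (lev i \<union> B)"
    by (rule complement_in_forms[OF lev_forms])
  have "lev i \<union> chain (Suc i) \<subseteq> lev (Suc i)" using lev_Suc chain_subset_lev by blast
  then have "cpoly.dim (lev i \<union> chain (Suc i)) \<le> cpoly.dim (lev (Suc i))"
    by (intro dim_mono_forms[OF subset_trans[OF _ cpoly.span_superset] lev_forms])
  then have cardB: "card B \<le> D (Suc i) - D i" using B(3) dim_lev[of i] dim_lev[of "Suc i"] by linarith
  have lev_span: "lev (Suc i) \<subseteq> cspan (lev i \<union> B)"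
  proof -
    have "lev i \<union> chain (Suc i) \<subseteq> cspan (lev i \<union> B)"
      using B(4) cpoly.span_superset[of "lev i \<union> B"] by simp
    then show ?thesis
      using lev_Suc_subset_span_chain[of i] cpoly.span_minimal[OF _ cpoly.subspace_span] by blast
  qed
  \<comment> \<open>\<open>chain_mult\<close> is used with \<open>s = 0\<close>, where
    \<open>lev 0 = U\<close>.\<close>
  have "\<exists>G. finite G \<and> card G \<le> (\<Sum>j\<le>Suc i. D j) \<and>
    (\<forall>x\<in>forms n (d - Suc i). l ^ Suc i * x \<in> U \<longrightarrow> b * (l ^ Suc i * x) \<in> cspan (SQ \<union> G))" if "b \<in> B" for b
    using chain_mult[of b "Suc i" 0] that B(1) Suc.prems k_less_d
    by (auto simp: atMost_atLeast0 simp del: power_Suc sum.cl_ivl_Suc chain.simps)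
  then obtain G where G: "\<And>b. b \<in> B \<Longrightarrow> finite (G b)" "\<And>b. b \<in> B \<Longrightarrow> card (G b) \<le> (\<Sum>j\<le>Suc i. D j)"
    "\<And>b x. b \<in> B \<Longrightarrow> x \<in> forms n (d - Suc i) \<Longrightarrow> l ^ Suc i * x \<in> U \<Longrightarrow> b * (l ^ Suc i * x) \<in> cspan (SQ \<union> G b)"
    by metis
  define F' where "F' = F \<union> (\<Union>b\<in>B. G b)"
  have "card (\<Union>b\<in>B. G b) \<le> card B * (\<Sum>j\<le>Suc i. D j)"
    using card_UN_le[OF B(2), of G] sum_bounded_above[of B "\<lambda>b. card (G b)", OF G(2)] by simp
  then have cardF': "card F' \<le> ((D i + 2) choose 3) + (D (Suc i) - D i) * (\<Sum>j\<le>Suc i. D j)"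
    using card_Un_le[of F "\<Union>b\<in>B. G b"] F(2) mult_right_mono[OF cardB, of "\<Sum>j\<le>Suc i. D j"]
    unfolding F'_def by linarith
  also have "\<dots> \<le> (D (Suc i) + 2) choose 3"
  proof (cases "D i < k")
    case True
    have "(\<Sum>j\<le>Suc i. D j) \<le> (Suc (D i) choose 2) + D i + (D (Suc i) - D i)"
      using sum_D_le[OF True] D_mono[of i] by simp
    from choose_three_add_ge[OF this] show ?thesis using D_mono[of i] by simp
  next
    case False
    then have "D i = D (Suc i)" using D_le[of i] D_le[of "Suc i"] D_mono[of i] by linarith
    then show ?thesis by simp
  qed
  finally have "card F' \<le> (D (Suc i) + 2) choose 3" .
  moreover have "finite F'" unfolding F'_def using F(1) G(1) B(2) by simp
  moreover have "(l ^ j * p) * f \<in> cspan (SQ \<union> F')"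
    if "j \<le> Suc i" "f \<in> lev j" "p \<in> forms n (d - j)" "l ^ j * p \<in> U" for j f p
  proof -
    have FF': "cspan (SQ \<union> F) \<subseteq> cspan (SQ \<union> F')" by (rule cpoly.span_mono) (auto simp: F'_def)
    show ?thesis
    proof (cases "j = Suc i")
      case True
      note p = that(3,4)[unfolded True]
      have "d - i = Suc (d - Suc i)" using Suc.prems k_less_d by simp
      then have lp: "l * p \<in> forms n (d - i)" "l ^ i * (l * p) = l ^ Suc i * p"
        using l_mult_forms[OF p(1)] by (simp_all add: mult_ac)
      have "(l ^ Suc i * p) * f \<in> cspan (SQ \<union> F')"
      proof (rule mult_in_subspace[OF cpoly.subspace_span])
        show "f \<in> cspan (lev i \<union> B)" using that(2) lev_span True by blast
        fix s assume "s \<in> lev i \<union> B"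
        then show "(l ^ Suc i * p) * s \<in> cspan (SQ \<union> F')"
        proof
          assume "s \<in> lev i"
          then show ?thesis using F(3)[OF order_refl _ lp(1), of s] p(2) FF' unfolding lp(2) by blast
        next
          assume "s \<in> B"
          moreover have "cspan (SQ \<union> G s) \<subseteq> cspan (SQ \<union> F')"
            using \<open>s \<in> B\<close> by (intro cpoly.span_mono) (auto simp: F'_def)
          ultimately show ?thesis using G(3)[OF \<open>s \<in> B\<close> p] by (auto simp: mult.commute)
        qed
      qed
      then show ?thesis by (simp only: True)
    next
      case False
      then show ?thesis using F(3)[of j f p] that FF' by auto
    qed
  qed
  ultimately show ?case by blast
qed

end

subsection \<open>Spanning the forms of degree \<open>2 d\<close>\<close>

context generic_linear_form
begin

lemma Y_subset_span_tail:
  assumes "\<forall>e\<le>d. Y e \<subseteq> cspan (Y (Suc e) \<union> B e)" "m \<le> Suc d"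
  shows "Y m \<subseteq> cspan (U \<union> (\<Union>e\<in>{m..d}. B e))"
  using assms(2)
proof (induction rule: inc_induct)
  case base
  show ?case by (simp add: Y_Suc_d cpoly.span_superset)
next
  case (step e)
  let ?T = "cspan (U \<union> (\<Union>e'\<in>{e..d}. B e'))"
  have "cspan (U \<union> (\<Union>e'\<in>{Suc e..d}. B e')) \<subseteq> ?T" by (intro cpoly.span_mono) fastforce
  moreover have "B e \<subseteq> ?T"
  proof -
    have "B e \<subseteq> U \<union> (\<Union>e'\<in>{e..d}. B e')" using step(2) by auto
    then show ?thesis using cpoly.span_superset by (rule subset_trans)
  qed
  ultimately have "cspan (Y (Suc e) \<union> B e) \<subseteq> ?T"
    using step(3) by (intro cpoly.span_minimal) auto
  then show ?case using assms(1) step(2) by (meson less_Suc_eq_le subset_trans)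
qed

text \<open>The adapted basis elements with exponents at least \<open>e\<close> are all multiples of
  \<open>l^e\<close>. So when \<open>l^e g\<close> is expanded in \<open>U\<close> and these
  elements, its component in \<open>U\<close> is a multiple of \<open>l^e\<close> too.\<close>

lemma exists_adapted_complement:
  "\<exists>V. finite V \<and> card V \<le> k \<and> V \<subseteq> (*) l ` forms n (d - 1) \<and> forms n d \<subseteq> cspan (U \<union> V) \<and>
    (\<forall>e g. 1 \<le> e \<longrightarrow> e \<le> d \<longrightarrow> g \<in> forms n (d - e) \<longrightarrow>
      (\<exists>w\<in>forms n (d - e). \<exists>v\<in>cspan V. l ^ e * w \<in> U \<and> l ^ e * g = l ^ e * w + v))"
proof -
  obtain B where B: "\<forall>e\<le>d. finite (B e) \<and> B e \<subseteq> (*) (l ^ e) ` forms n (d - e) \<and> Y e \<subseteq> cspan (Y (Suc e) \<union> B e)"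
    "(\<Sum>e\<le>d. card (B e)) = k"
    using exists_adapted_basis by blast
  \<comment> \<open>Exponent \<open>0\<close> is left out, as \<open>A_d = U + l A_(d-1)\<close>;
    thus every element of \<open>V\<close> is divisible by \<open>l\<close>.\<close>
  define V where "V = (\<Union>e\<in>{1..d}. B e)"
  have tail: "Y m \<subseteq> cspan (U \<union> (\<Union>e\<in>{m..d}. B e))" if "m \<le> Suc d" for m
    using Y_subset_span_tail[OF _ that] B(1) by blast
  have "card V \<le> (\<Sum>e\<in>{1..d}. card (B e))" unfolding V_def by (rule card_UN_le) simp
  also have "\<dots> \<le> (\<Sum>e\<le>d. card (B e))" by (intro sum_mono2) auto
  finally have "card V \<le> k" using B(2) by simp
  moreover have "finite V" unfolding V_def using B(1) by auto
  moreover have "V \<subseteq> (*) l ` forms n (d - 1)"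
  proof
    fix v assume "v \<in> V"
    then obtain e where e: "1 \<le> e" "e \<le> d" "v \<in> B e" by (auto simp: V_def)
    then obtain g where g: "g \<in> forms n (d - e)" "v = l ^ e * g" using B(1) by blast
    have "e - 1 + (d - e) = d - 1" using e by simp
    then have "l ^ (e - 1) * g \<in> forms n (d - 1)"
      using mult_in_forms[OF power_in_forms[OF l_forms, of "e - 1"] g(1)] by simp
    moreover have "v = l * (l ^ (e - 1) * g)"
      using e(1) g(2) by (cases e) (simp_all add: mult.assoc)
    ultimately show "v \<in> (*) l ` forms n (d - 1)" by blast
  qed
  moreover have "forms n d \<subseteq> cspan (U \<union> V)"
  proof
    fix f assume "f \<in> forms n d"
    then obtain u g where "u \<in> U" "g \<in> forms n (d - 1)" "f = u + l * g" by (rule forms_eq_U_plus_l)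
    moreover have "l ^ 1 * g \<in> Y 1" using calculation(2) k_less_d by (intro power_mult_in_Y) auto
    ultimately have "f \<in> Y 1" using U_subset_Y[of 1] by (auto intro: cpoly.subspace_add)
    then show "f \<in> cspan (U \<union> V)" using tail[of 1] by (auto simp: V_def)
  qed
  moreover have "\<exists>w\<in>forms n (d - e). \<exists>v\<in>cspan V. l ^ e * w \<in> U \<and> l ^ e * g = l ^ e * w + v"
    if e: "1 \<le> e" "e \<le> d" "g \<in> forms n (d - e)" for e g
  proof -
    let ?C = "\<Union>e'\<in>{e..d}. B e'"
    have "l ^ e * g \<in> cspan (U \<union> ?C)" using power_mult_in_Y[OF e(2,3)] tail[of e] e(2) by auto
    then obtain u v where uv: "u \<in> cspan U" "v \<in> cspan ?C" "l ^ e * g = u + v"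
      unfolding cpoly.span_Un by auto
    then have "u \<in> U" using cpoly.span_minimal[OF order_refl subspace_U] by blast
    have "v \<in> cspan V" using uv(2) cpoly.span_mono[of ?C V] e(1) by (force simp: V_def)
    have "?C \<subseteq> (*) (l ^ e) ` forms n (d - e)"
    proof
      fix b assume "b \<in> ?C"
      then obtain e' where e': "e \<le> e'" "e' \<le> d" "b \<in> B e'" by auto
      then obtain h where h: "h \<in> forms n (d - e')" "b = l ^ e' * h" using B(1) by blast
      have "e' - e + (d - e') = d - e" using e' by simp
      then have "l ^ (e' - e) * h \<in> forms n (d - e)"
        using mult_in_forms[OF power_in_forms[OF l_forms, of "e' - e"] h(1)] by simp
      moreover have "b = l ^ e * (l ^ (e' - e) * h)"
        unfolding h(2) mult.assoc[symmetric] power_add[symmetric] using e'(1) by simp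
      ultimately show "b \<in> (*) (l ^ e) ` forms n (d - e)" by blast
    qed
    moreover have "cpoly.subspace ((*) (l ^ e) ` forms n (d - e))"
      unfolding cpoly.subspace_def
    proof (intro conjI ballI allI)
      show "0 \<in> (*) (l ^ e) ` forms n (d - e)"
        using cpoly.subspace_0[OF subspace_forms] by (intro image_eqI[of _ _ 0]) simp_all
      fix x y assume "x \<in> (*) (l ^ e) ` forms n (d - e)" "y \<in> (*) (l ^ e) ` forms n (d - e)"
      then show "x + y \<in> (*) (l ^ e) ` forms n (d - e)"
        using cpoly.subspace_add[OF subspace_forms] by (auto simp flip: distrib_left)
    next
      fix c x assume "x \<in> (*) (l ^ e) ` forms n (d - e)"
      then obtain h where "h \<in> forms n (d - e)" "x = l ^ e * h" by blast
      then show "Defs.smult c x \<in> (*) (l ^ e) ` forms n (d - e)"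
        using cpoly.subspace_scale[OF subspace_forms, of h n "d - e" c]
        by (intro image_eqI[of _ _ "Defs.smult c h"]) simp_all
    qed
    ultimately have "cspan ?C \<subseteq> (*) (l ^ e) ` forms n (d - e)" by (rule cpoly.span_minimal)
    then obtain h where h: "h \<in> forms n (d - e)" "v = l ^ e * h" using uv(2) by blast
    have "g - h \<in> forms n (d - e)" using e(3) h(1) by (rule cpoly.subspace_diff[OF subspace_forms])
    moreover have "l ^ e * (g - h) \<in> U"
      using uv(3) h(2) \<open>u \<in> U\<close> by (simp add: right_diff_distrib)
    moreover have "l ^ e * g = l ^ e * (g - h) + v" using h(2) by (simp add: right_diff_distrib)
    ultimately show ?thesis using \<open>v \<in> cspan V\<close> by blast
  qed
  ultimately show ?thesis by (intro exI[of _ V]) simp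
qed

section \<open>Counting the generators of \<open>J\<close> in each degree\<close>

definition codim_up_J :: "nat \<Rightarrow> nat" where "codim_up_J \<nu> = codim (forms n (Suc \<nu>)) (up n (J \<nu>))"

text \<open>One of the \<open>\<nu>\<close> copies is bounded by \<open>codim_up_le_choose\<close>,
  the other \<open>\<nu> - 1\<close> by \<open>codim_up_le_mult\<close> with \<open>K\<close>
  running through \<open>J 1\<close>, ..., \<open>J (\<nu> - 1)\<close>.\<close>

lemma mult_codim_up_J_le:
  assumes "0 < \<nu>" "\<nu> < d"
  shows "\<nu> * codim_up_J \<nu> \<le> tau \<nu> * (\<Sum>i<\<nu>. tau i) + (tau \<nu> choose 2)"
proof -
  obtain e where e: "\<nu> = Suc e" using assms(1) by (cases \<nu>) auto
  have q_choose: "codim_up_J \<nu> \<le> Suc (tau \<nu>) choose 2"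
    using codim_up_le_choose[OF subspace_J, of "Suc e" n e] J_forms by (simp add: codim_up_J_def tau_def e)
  have q_mult: "codim_up_J \<nu> \<le> tau \<nu> * tau (Suc a)" if "a < e" for a
  proof -
    have "g * h \<in> J (Suc e)" if "g \<in> forms n (e - a)" "h \<in> J (Suc a)" for g h
      using forms_mult_J[OF that] assms(2) \<open>a < e\<close> e by simp
    then show ?thesis
      using codim_up_le_mult[OF subspace_J J_forms subspace_J J_forms, of a e] \<open>a < e\<close>
      by (simp add: codim_up_J_def tau_def e)
  qed
  \<comment> \<open>The term \<open>tau \<nu> * tau 0\<close> pays for the linear part of
    \<open>Suc (tau \<nu>) choose 2\<close>; if \<open>tau 0 = 0\<close>, then
    \<open>tau \<nu> = 0\<close> as well.\<close>
  have 1: "tau \<nu> \<le> tau \<nu> * tau 0"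
    using tau_eq_0_mono[of 0 \<nu>] assms(2) by (cases "tau 0") auto
  have 2: "e * codim_up_J \<nu> \<le> (\<Sum>a<e. tau \<nu> * tau (Suc a))"
    using sum_mono[of "{..<e}" "\<lambda>_. codim_up_J \<nu>" "\<lambda>a. tau \<nu> * tau (Suc a)"] q_mult by simp
  have "(\<Sum>i<\<nu>. tau i) = tau 0 + (\<Sum>a<e. tau (Suc a))"
    unfolding e by (rule sum.lessThan_Suc_shift)
  then have 3: "tau \<nu> * (\<Sum>i<\<nu>. tau i) = tau \<nu> * tau 0 + (\<Sum>a<e. tau \<nu> * tau (Suc a))"
    by (simp add: distrib_left sum_distrib_left)
  have 4: "Suc (tau \<nu>) choose 2 = tau \<nu> + (tau \<nu> choose 2)" by (simp add: numeral_2_eq_2)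
  have "\<nu> * codim_up_J \<nu> = codim_up_J \<nu> + e * codim_up_J \<nu>" by (simp add: e)
  then show ?thesis using 1 2 3 4 q_choose by linarith
qed

text \<open>From \<open>j \<le> D j\<close> and \<open>k < d\<close> one gets
  \<open>k - D j \<le> d - Suc j\<close>, so \<open>mult_codim_up_J_le\<close> bounds each summand.
  By \<open>sum_choose_two\<close> these bounds count pairs in blocks of sizes \<open>tau i\<close>,
  of total size at most \<open>k\<close>.\<close>

lemma sum_codim_up_J_le: "(\<Sum>j<k. codim_up_J (d - Suc j) * (k - D j)) \<le> k choose 2"
proof -
  define h where "h \<nu> = tau \<nu> * (\<Sum>i<\<nu>. tau i) + (tau \<nu> choose 2)" for \<nu>
  have "codim_up_J (d - Suc j) * (k - D j) \<le> h (d - Suc j)" if "j < k" for j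
  proof -
    have "k - D j \<le> d - Suc j" using D_ge[of j] that k_less_d by simp
    then have "codim_up_J (d - Suc j) * (k - D j) \<le> (d - Suc j) * codim_up_J (d - Suc j)" by (simp add: mult.commute)
    also have "\<dots> \<le> h (d - Suc j)" unfolding h_def using that k_less_d by (intro mult_codim_up_J_le) auto
    finally show ?thesis .
  qed
  then have "(\<Sum>j<k. codim_up_J (d - Suc j) * (k - D j)) \<le> (\<Sum>j<k. h (d - Suc j))" by (intro sum_mono) simp
  also have "\<dots> = (\<Sum>\<nu>\<in>(\<lambda>j. d - Suc j) ` {..<k}. h \<nu>)"
    using k_less_d by (subst sum.reindex) (auto simp: inj_on_def)
  also have "\<dots> \<le> (\<Sum>\<nu><d. h \<nu>)" using k_less_d by (intro sum_mono2) auto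
  also have "\<dots> = (\<Sum>i<d. tau i) choose 2" unfolding h_def by (rule sum_choose_two)
  also have "\<dots> \<le> k choose 2"
  proof (rule binomial_right_mono)
    have "(\<Sum>i<d. tau i) \<le> (\<Sum>i\<le>d. tau i)" by (intro sum_mono2) auto
    then show "(\<Sum>i<d. tau i) \<le> k" using sum_tau_le by linarith
  qed
  finally show ?thesis .
qed

text \<open>\<open>P\<close> supplies what \<open>(U : l^j)\<close> has beyond the multiples of
  \<open>J\<close> from one degree lower, \<open>W\<close> what \<open>V\<close> has beyond
  \<open>lev j\<close>. Their products are those that the induction in
  \<open>codim_square_span_le\<close> cannot reduce.\<close>

lemma exceptional_products:
  assumes V: "finite V" "V \<subseteq> forms n d" "forms n d \<subseteq> cspan (U \<union> V)" and j: "j < k"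
  shows "\<exists>P W. finite P \<and> finite W \<and> card P \<le> codim_up_J (d - Suc j) \<and> card W \<le> k - D j \<and> W \<subseteq> V \<and>
    forms n d \<subseteq> cspan (lev j \<union> W) \<and>
    (\<forall>p\<in>forms n (d - j). l ^ j * p \<in> U \<longrightarrow> p \<in> cspan (up n (J (d - Suc j)) \<union> P))"
proof -
  have dj: "Suc (d - Suc j) = d - j" using j k_less_d by simp
  obtain W where W: "W \<subseteq> V" "finite W" "card W + cpoly.dim (lev j) = cpoly.dim (lev j \<union> V)"
    "V \<subseteq> cspan (lev j \<union> W)"
    by (rule complement_in_forms[OF lev_forms V(2)])
  have "cpoly.dim (lev j \<union> V) \<le> cpoly.dim (forms n d)" using lev_forms V(2) by (intro dim_le_dim_forms) auto
  then have "card W \<le> k - D j" using W(3) by (simp add: dim_lev dim_forms)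
  moreover have "forms n d \<subseteq> cspan (lev j \<union> W)"
  proof -
    have "U \<union> V \<subseteq> cspan (lev j \<union> W)"
      using W(4) U_subset_lev[of j] cpoly.span_superset[of "lev j \<union> W"] by auto
    then show ?thesis using V(3) cpoly.span_minimal[OF _ cpoly.subspace_span] by blast
  qed
  moreover define C where "C = {p \<in> forms n (d - j). l ^ j * p \<in> U}"
  have upf: "up n (J (d - Suc j)) \<subseteq> forms n (d - j)"
    using up_in_forms[OF J_forms[of "d - Suc j"]] dj by simp
  have Cf: "C \<subseteq> forms n (d - j)" by (auto simp: C_def)
  obtain P where P: "P \<subseteq> C" "finite P"
    "card P + cpoly.dim (up n (J (d - Suc j))) = cpoly.dim (up n (J (d - Suc j)) \<union> C)"
    "C \<subseteq> cspan (up n (J (d - Suc j)) \<union> P)"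
    by (rule complement_in_forms[OF upf Cf])
  have "cpoly.dim (up n (J (d - Suc j)) \<union> C) \<le> cpoly.dim (forms n (d - j))"
    using upf Cf by (intro dim_le_dim_forms) auto
  then have "card P \<le> codim_up_J (d - Suc j)" using P(3) unfolding codim_up_J_def codim_def dj by linarith
  ultimately show ?thesis
    using W(1,2) P(2,4) by (intro exI[of _ P] exI[of _ W]) (auto simp: C_def)
qed

text \<open>\<open>F\<close> accounts for \<open>(k + 2) choose 3\<close>, \<open>PV\<close> for
  \<open>(k + 1) choose 2\<close> and \<open>Ex\<close> for \<open>k choose 2\<close>; the last two
  add up to \<open>k^2\<close>.\<close>

lemma codim_square_span_le: "codim (forms n (2 * d)) (square_span U) \<le> k ^ 2 + ((k + 2) choose 3)"
proof -
  obtain F where F: "finite F" "card F \<le> (D k + 2) choose 3"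
    "\<And>j f p. j \<le> k \<Longrightarrow> f \<in> lev j \<Longrightarrow> p \<in> forms n (d - j) \<Longrightarrow> l ^ j * p \<in> U \<Longrightarrow> (l ^ j * p) * f \<in> cspan (SQ \<union> F)"
    using level_products[OF order_refl] by blast
  obtain V where V: "finite V" "card V \<le> k" "V \<subseteq> (*) l ` forms n (d - 1)" "forms n d \<subseteq> cspan (U \<union> V)"
    "\<And>e g. 1 \<le> e \<Longrightarrow> e \<le> d \<Longrightarrow> g \<in> forms n (d - e) \<Longrightarrow>
      \<exists>w\<in>forms n (d - e). \<exists>v\<in>cspan V. l ^ e * w \<in> U \<and> l ^ e * g = l ^ e * w + v"
    using exists_adapted_complement by metis
  have Vf: "V \<subseteq> forms n d" using V(3) l_mult_forms[of _ "d - 1"] d1 by auto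
  define Q where "Q j P W \<longleftrightarrow> finite P \<and> finite W \<and> card P \<le> codim_up_J (d - Suc j) \<and> card W \<le> k - D j \<and> W \<subseteq> V \<and>
    forms n d \<subseteq> cspan (lev j \<union> W) \<and>
    (\<forall>p\<in>forms n (d - j). l ^ j * p \<in> U \<longrightarrow> p \<in> cspan (up n (J (d - Suc j)) \<union> P))" for j P W
  have "\<exists>P W. Q j P W" if "j < k" for j
    unfolding Q_def by (rule exceptional_products[OF V(1) Vf V(4) that])
  then obtain P W where "\<And>j. j < k \<Longrightarrow> Q j (P j) (W j)" by metis
  then have PW: "\<And>j. j < k \<Longrightarrow> finite (P j)" "\<And>j. j < k \<Longrightarrow> finite (W j)"
    "\<And>j. j < k \<Longrightarrow> card (P j) \<le> codim_up_J (d - Suc j)" "\<And>j. j < k \<Longrightarrow> card (W j) \<le> k - D j"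
    "\<And>j. j < k \<Longrightarrow> W j \<subseteq> V" "\<And>j. j < k \<Longrightarrow> forms n d \<subseteq> cspan (lev j \<union> W j)"
    "\<And>j p. j < k \<Longrightarrow> p \<in> forms n (d - j) \<Longrightarrow> l ^ j * p \<in> U \<Longrightarrow> p \<in> cspan (up n (J (d - Suc j)) \<union> P j)"
    by (simp_all add: Q_def)
  define PV where "PV = {v * w |v w. v \<in> V \<and> w \<in> V}"
  define Ex where "Ex = (\<Union>j<k. (\<lambda>(p, f). (l ^ j * p) * f) ` (P j \<times> W j))"
  define E where "E = F \<union> PV \<union> Ex"
  let ?T = "cspan (SQ \<union> E)"
  have sub: "cspan (SQ \<union> F) \<subseteq> ?T" "PV \<subseteq> ?T" "Ex \<subseteq> ?T"
    using cpoly.span_superset[of "SQ \<union> E"] by (auto simp: E_def intro!: cpoly.span_mono)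
  have VV: "v * w \<in> ?T" if "v \<in> cspan V" "w \<in> V" for v w
  proof -
    have "w * v \<in> ?T"
      using that sub(2) by (intro mult_in_subspace[OF cpoly.subspace_span _ that(1)]) (auto simp: PV_def)
    then show ?thesis by (simp add: mult.commute)
  qed
  \<comment> \<open>Downward induction from \<open>j = k\<close>, where \<open>lev k = A_d\<close>,
    to \<open>j = 0\<close>, where the claim covers \<open>U A_d\<close>.\<close>
  have R: "(l ^ j * p) * f \<in> ?T" if "j \<le> k" "p \<in> forms n (d - j)" "l ^ j * p \<in> U" "f \<in> forms n d" for j p f
    using that
  proof (induction arbitrary: p f rule: inc_induct)
    case base
    then show ?case using F(3)[OF order_refl, of f p] sub(1) by (auto simp: lev_k)
  next
    case (step j)
    show ?case
    proof (rule mult_in_subspace[OF cpoly.subspace_span _ subsetD[OF PW(6)[OF step(2)] step.prems(3)]])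
      fix f assume "f \<in> lev j \<union> W j"
      then show "(l ^ j * p) * f \<in> ?T"
      proof
        assume "f \<in> lev j"
        then show ?thesis using F(3)[of j f p] step sub(1) by auto
      next
        assume f: "f \<in> W j"
        then have "f \<in> V" using PW(5) step(2) by blast
        then obtain r where r: "r \<in> forms n (d - 1)" "f = l * r" using V(3) by blast
        define \<nu> where "\<nu> = d - Suc j"
        have \<nu>: "d - \<nu> = Suc j" "0 < \<nu>" "\<nu> \<le> d" "Suc (\<nu> - 1) = \<nu>"
          using step(2) k_less_d by (auto simp: \<nu>_def)
        \<comment> \<open>Write a generator as \<open>x_i w\<close> with
          \<open>w = w1 + l r1\<close>. Moving the \<open>l\<close> of \<open>f = l r\<close> to the
          other factor gives \<open>(l^j f) x_i w1 = (l^(j+1) w1) (x_i r)\<close>, an instance of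
          the induction hypothesis.\<close>
        have up: "(l ^ j * f) * s \<in> ?T" if "s \<in> up n (J \<nu>)" for s
        proof (rule mult_in_subspace[OF cpoly.subspace_span _ that[unfolded up_def]])
          fix t assume "t \<in> {var i * w |i w. i < n \<and> w \<in> J \<nu>}"
          then obtain i w where t: "t = var i * w" "i < n" "w \<in> J \<nu>" by blast
          obtain w1 r1 where w: "w1 \<in> forms n \<nu>" "l ^ Suc j * w1 \<in> U" "w = w1 + l * r1" "r1 \<in> forms n (\<nu> - 1)"
            using J_elim[OF t(3) \<nu>(3)] \<nu>(1) by metis
          have "var i * r \<in> forms n d" using var_mult_in_forms[OF t(2) r(1)] d1 by simp
          then have 1: "(l ^ Suc j * w1) * (var i * r) \<in> ?T" using step.IH[of w1] w(1,2) by (simp add: \<nu>_def)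
          have vr: "var i * r1 \<in> forms n (d - Suc j)"
            using var_mult_in_forms[OF t(2) w(4)] \<nu>(4) by (simp add: \<nu>_def)
          \<comment> \<open>For the part \<open>l r1\<close>, the adapted complement splits
            \<open>l^(j+1) x_i r1\<close> into \<open>l^(j+1) g\<close> in \<open>U\<close>, to
            which the induction hypothesis applies, and \<open>v\<close> in the span of
            \<open>V\<close>, whose product with \<open>f\<close> is covered by
            \<open>PV\<close>.\<close>
          obtain g v where g: "g \<in> forms n (d - Suc j)" "v \<in> cspan V" "l ^ Suc j * g \<in> U"
            "l ^ Suc j * (var i * r1) = l ^ Suc j * g + v"
            using V(5)[OF _ _ vr] step(2) k_less_d by auto
          have "(l ^ Suc j * g) * f \<in> ?T" using step.IH[OF g(1,3)] \<open>f \<in> V\<close> Vf by blast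
          moreover have "v * f \<in> ?T" by (rule VV[OF g(2) \<open>f \<in> V\<close>])
          ultimately have "(l ^ Suc j * (var i * r1)) * f \<in> ?T"
            unfolding g(4) distrib_right by (rule cpoly.span_add)
          from cpoly.span_add[OF 1 this] show "(l ^ j * f) * t \<in> ?T"
            by (simp add: t(1) w(3) r(2) algebra_simps)
        qed
        have "(l ^ j * f) * p \<in> ?T"
        proof (rule mult_in_subspace[OF cpoly.subspace_span _ PW(7)[OF step(2) step.prems(1,2)]])
          fix s assume "s \<in> up n (J (d - Suc j)) \<union> P j"
          then show "(l ^ j * f) * s \<in> ?T"
          proof
            assume "s \<in> up n (J (d - Suc j))" then show ?thesis using up by (simp add: \<nu>_def)
          next
            assume "s \<in> P j"
            then have "(l ^ j * s) * f \<in> Ex" using f step(2) by (force simp: Ex_def)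
            then show ?thesis using sub(3) by (auto simp: mult_ac)
          qed
        qed
        then show ?thesis by (simp add: mult_ac)
      qed
    qed
  qed
  have U_mult: "u * f \<in> ?T" "f * u \<in> ?T" if "u \<in> U" "f \<in> forms n d" for u f
    using R[of 0 u f] that U_forms by (auto simp: mult.commute)
  have "f * g \<in> ?T" if "f \<in> forms n d" "g \<in> forms n d" for f g
  proof (rule mult_in_subspace2[OF cpoly.subspace_span])
    show "f \<in> cspan (U \<union> V)" "g \<in> cspan (U \<union> V)" using that V(4) by auto
    fix s t assume "s \<in> U \<union> V" "t \<in> U \<union> V"
    then show "s * t \<in> ?T"
      using U_mult[of s t] U_mult[of t s] VV[OF cpoly.span_base, of s t] U_forms Vf by blast
  qed
  then have "{f * g |f g. f \<in> forms n d \<and> g \<in> forms n d} \<subseteq> ?T" by blast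
  then have cover: "forms n (2 * d) \<subseteq> ?T"
    using forms_add_subset_span[of n d d] cpoly.span_minimal[OF _ cpoly.subspace_span]
    unfolding mult_2 by blast
  have PV: "finite PV" "card PV \<le> Suc (card V) choose 2"
    unfolding PV_def using card_products_le[OF V(1)] by auto
  have Ex: "finite Ex" "card Ex \<le> k choose 2"
  proof -
    show "finite Ex" unfolding Ex_def using PW(1,2) by auto
    have "card Ex \<le> (\<Sum>j<k. card ((\<lambda>(p, f). (l ^ j * p) * f) ` (P j \<times> W j)))"
      unfolding Ex_def by (rule card_UN_le) simp
    also have "\<dots> \<le> (\<Sum>j<k. codim_up_J (d - Suc j) * (k - D j))"
    proof (rule sum_mono)
      fix j assume "j \<in> {..<k}"
      then have "card ((\<lambda>(p, f). (l ^ j * p) * f) ` (P j \<times> W j)) \<le> card (P j \<times> W j)"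
        using PW(1,2) by (intro card_image_le) auto
      also have "\<dots> \<le> codim_up_J (d - Suc j) * (k - D j)"
        using PW(3,4) \<open>j \<in> {..<k}\<close> unfolding card_cartesian_product by (intro mult_le_mono) auto
      finally show "card ((\<lambda>(p, f). (l ^ j * p) * f) ` (P j \<times> W j)) \<le> codim_up_J (d - Suc j) * (k - D j)" .
    qed
    also have "\<dots> \<le> k choose 2" by (rule sum_codim_up_J_le)
    finally show "card Ex \<le> k choose 2" .
  qed
  have "codim (forms n (2 * d)) SQ \<le> card E"
    using F(1) PV(1) Ex(1)
    by (intro codim_forms_le_card[OF cover square_span_subset_forms[OF U_forms]]) (simp add: E_def)
  also have "card E \<le> card F + card PV + card Ex"
    unfolding E_def using card_Un_le[of "F \<union> PV" Ex] card_Un_le[of F PV] by linarith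
  also have "card F \<le> (k + 2) choose 3"
    using F(2) D_le[of k] by (intro order_trans[OF F(2)] binomial_right_mono) simp
  also have "card PV \<le> Suc k choose 2"
    using V(2) by (intro order_trans[OF PV(2)] binomial_right_mono) simp
  also have "card Ex \<le> k choose 2" by (rule Ex(2))
  also have "((k + 2) choose 3) + (Suc k choose 2) + (k choose 2) = k ^ 2 + ((k + 2) choose 3)"
  proof -
    have "(Suc k choose 2) + (k choose 2) = k ^ 2"
      by (induction k) (simp_all add: numeral_2_eq_2)
    then show ?thesis by simp
  qed
  finally show ?thesis by simp
qed

end

theorem theorem8p12:
  fixes d k :: nat
  assumes "d \<ge> 2" and "k \<ge> 1" and "k \<le> d - 1"
  shows "(\<forall>n U. n \<ge> 2 \<longrightarrow> cpoly.subspace U \<longrightarrow> U \<subseteq> forms n d \<longrightarrow> base_point_free n U \<longrightarrow>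
            codim (forms n d) U = k \<longrightarrow>
            codim (forms n (2 * d)) (square_span U) \<le> k ^ 2 + ((k + 2) choose 3))
         \<and> real (k ^ 2 + ((k + 2) choose 3)) = 1 / 6 * (real k ^ 3 + 9 * real k ^ 2 + 2 * real k)"
proof (intro conjI allI impI)
  fix n U
  assume U: "cpoly.subspace U" "U \<subseteq> forms n d" "base_point_free n U" "codim (forms n d) U = k"
  obtain l where l: "l \<in> forms n 1" "\<And>l'. l' \<in> forms n 1 \<Longrightarrow> total_rank n d U l' \<le> total_rank n d U l"
    using exists_maximal_total_rank[OF U(2)] by blast
  interpret generic_linear_form n d k U l
    using U l assms maximal_total_rank_absorbs[OF U(1,2) l] by unfold_locales auto
  show "codim (forms n (2 * d)) (square_span U) \<le> k ^ 2 + ((k + 2) choose 3)"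
    by (rule codim_square_span_le)
next
  have choose_2: "2 * ((m + 2) choose 2) = (m + 1) * (m + 2)" for m :: nat
    by (induction m) (simp_all add: numeral_2_eq_2)
  \<comment> \<open>Pascal's rule, with the denominator \<open>6\<close> cleared to stay in the
    naturals.\<close>
  have "6 * ((k + 2) choose 3) = k * (k + 1) * (k + 2)"
  proof (induction k)
    case (Suc m)
    have "(Suc m + 2) choose 3 = ((m + 2) choose 3) + ((m + 2) choose 2)"
      by (simp add: numeral_3_eq_3 numeral_2_eq_2)
    then have "6 * ((Suc m + 2) choose 3) = m * (m + 1) * (m + 2) + 3 * ((m + 1) * (m + 2))"
      using Suc choose_2[of m] by linarith
    then show ?case by (simp add: algebra_simps)
  qed (simp add: numeral_3_eq_3 numeral_2_eq_2)
  then have "6 * real ((k + 2) choose 3) = real k * (real k + 1) * (real k + 2)"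
    by (metis (mono_tags, lifting) of_nat_1 of_nat_add of_nat_mult of_nat_numeral)
  then show "real (k ^ 2 + ((k + 2) choose 3)) = 1 / 6 * (real k ^ 3 + 9 * real k ^ 2 + 2 * real k)"
    by (simp add: field_simps power2_eq_square power3_eq_cube)
qed

end
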